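(* Let the uniform mixing Assumption C hold, let $x(t)$ be defined by the EMD update with non-increasing stepsize sequence $\{\alpha(t)\}$, let $x^\star\in X$ be arbitrary, let the compactness condition $D_\psi(x,y)\le\frac12R^2$ ($x,y\in X$) hold, and let Assumption B (Lipschitz, constant $G$) hold. Let $\delta\in(0,1)$ and $\widehat x(T)=\frac1T\sum_{t=1}^Tx(t)$. With probability at least $1-\delta$, for $\epsilon>0$ such that $\tau_{\mathrm{TV}}(P,\epsilon)\le T/2$, $$f(\widehat x(T))-f(x^\star)\le\frac{R^2}{2T\alpha(T)}+\frac{G^2}{2T}\sum_{t=1}^T\alpha(t)+\frac{\tau_{\mathrm{TV}}(P,\epsilon)-1}{T}\Big[G^2\sum_{t=1}^T\alpha(t)+GR\Big]+\epsilon GR+4GR\sqrt{\frac{\tau_{\mathrm{TV}}(P,\epsilon)\log\frac{\tau_{\mathrm{TV}}(P,\epsilon)}{\delta}}{T}}.$$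
   Context: Setting. $\Pi$ is a probability distribution on a sample space $\Xi$, and $X\subseteq\mathbb{R}^d$ is a compact convex set. $\{F(\cdot;\xi):\xi\in\Xi\}$ is a collection of closed convex functions whose domains contain $X$, and $f:X\to\mathbb{R}$ is $f(x)=\mathbb{E}_\Pi[F(x;\xi)]$. $\mathsf g(x;\xi)\in\partial F(x;\xi)$ is a fixed measurable selection of subgradients. $\|\cdot\|$ is a norm. The function $\psi$ is differentiable and convex on $X$ and $1$-strongly convex with respect to $\|\cdot\|$ over $X$: $\psi(y)\ge\psi(x)+\langle\nabla\psi(x),y-x\rangle+\frac12\|x-y\|^2$ for $x,y\in X$. Put $D_\psi(x,y)=\psi(x)-\psi(y)-\langle\nabla\psi(y),x-y\rangle$; $R<\infty$ is such that $D_\psi(x,y)\le\frac12R^2$ for all $x,y\in X$. $\xi_1,\xi_2,\dots$ is a $\Xi$-valued stochastic process with law $P$ (neither Markov nor time-homogeneous in general), and $\mathcal F_t=\sigma(\xi_1,\dots,\xi_t)$. EMD (Ergodic Mirror Descent): $x(1)\in X$ is arbitrary, and with stepsizes $\alpha(t)>0$, $$g(t)=\mathsf g(x(t);\xi_t),\qquad x(t+1)=\operatorname{argmin}_{x\in X}\Big\{\langle g(t),x\rangle+\tfrac1{\alpha(t)}D_\psi(x,x(t))\Big\}.$$ Assumption B: for $\Pi$-almost every $\xi$, $F(\cdot;\xi)$ is $G$-Lipschitz over $X$ with respect to $\|\cdot\|$: $|F(x;\xi)-F(y;\xi)|\le G\|x-y\|$ for $x,y\in X$. Distances: for probability distributions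 $Q_1,Q_2$ with densities $q_1,q_2$ with respect to a measure $\mu$, $d_{\mathrm{TV}}(Q_1,Q_2)=\int|q_1-q_2|\,d\mu$ (no factor $1/2$) and $d_{\mathrm{hel}}(Q_1,Q_2)^2=\int(\sqrt{q_1}-\sqrt{q_2})^2d\mu$. Mixing times: $P^t_{[s]}$ is the distribution of $\xi_t$ conditioned on $\mathcal F_s$. $\tau_{\mathrm{TV}}(P_{[s]},\epsilon)$ is the smallest $t\in\mathbb{N}$ such that $d_{\mathrm{TV}}(P^{s+t}_{[s]},\Pi)\le\epsilon$, and $\tau_{\mathrm{hel}}(P_{[s]},\epsilon)$ is the smallest $t\in\mathbb{N}$ such that $d_{\mathrm{hel}}(P^{s+t}_{[s]},\Pi)\le\epsilon$ (an i.i.d. process from $\Pi$ has mixing times equal to 1). Assumption C (uniform mixing): there exist uniform mixing times $\tau_{\mathrm{TV}}(P,\epsilon),\tau_{\mathrm{hel}}(P,\epsilon)<\infty$ such that, with probability 1, $\tau_{\mathrm{TV}}(P,\epsilon)\ge\tau_{\mathrm{TV}}(P_{[s]},\epsilon)$ and $\tau_{\mathrm{hel}}(P,\epsilon)\ge\tau_{\mathrm{hel}}(P_{[s]},\epsilon)$ for all $\epsilon>0$ and $s\in\mathbb{N}$.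
   Formalization: Added, since the claim fails otherwise: almost surely the total-variation distance is at most ε at lag exactly τ_TV(P,ε), for every s including s=0; and almost surely the selected subgradients g(x;ξ_t) have dual norm at most G for all x in X and all t. *)

theory Defs
  imports "HOL-Probability.Probability"
begin

definition is_norm :: "('a::real_vector \<Rightarrow> real) \<Rightarrow> bool" where
  "is_norm n \<longleftrightarrow> (\<forall>x. 0 \<le> n x) \<and> (\<forall>x. n x = 0 \<longleftrightarrow> x = 0)
     \<and> (\<forall>c x. n (c *\<^sub>R x) = \<bar>c\<bar> * n x) \<and> (\<forall>x y. n (x + y) \<le> n x + n y)"

definition dual_norm :: "('a::euclidean_space \<Rightarrow> real) \<Rightarrow> 'a \<Rightarrow> real" where
  "dual_norm n g = (SUP v\<in>{v. n v \<le> 1}. g \<bullet> v)"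

text \<open>Convex functions on the whole space take values in the extended reals; their domain is
  the set of points where they are finite.  ``Closed'' means that the epigraph is closed.\<close>

definition ereal_epigraph :: "('a \<Rightarrow> ereal) \<Rightarrow> ('a \<times> real) set" where
  "ereal_epigraph h = {(x, r). h x \<le> ereal r}"

definition closed_convex_fun :: "('a::euclidean_space \<Rightarrow> ereal) \<Rightarrow> bool" where
  "closed_convex_fun h \<longleftrightarrow>
     (\<forall>x. h x \<noteq> -\<infinity>) \<and> convex (ereal_epigraph h) \<and> closed (ereal_epigraph h)"

definition effective_domain :: "('a \<Rightarrow> ereal) \<Rightarrow> 'a set" where
  "effective_domain h = {x. h x < \<infinity>}"

definition subdifferential :: "('a::euclidean_space \<Rightarrow> ereal) \<Rightarrow> 'a \<Rightarrow> 'a set" where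
  "subdifferential h x = {g. \<forall>y. h x + ereal (g \<bullet> (y - x)) \<le> h y}"

definition expected_fun :: "'x measure \<Rightarrow> ('a \<Rightarrow> 'x \<Rightarrow> ereal) \<Rightarrow> 'a \<Rightarrow> real" where
  "expected_fun \<pi> F x = (\<integral>\<xi>. real_of_ereal (F x \<xi>) \<partial>\<pi>)"

definition lipschitz_over :: "('a::real_vector \<Rightarrow> real) \<Rightarrow> real \<Rightarrow> 'a set \<Rightarrow> ('a \<Rightarrow> ereal) \<Rightarrow> bool" where
  "lipschitz_over n G X h \<longleftrightarrow> 0 \<le> G \<and>
     (\<forall>x\<in>X. \<forall>y\<in>X. \<bar>real_of_ereal (h x) - real_of_ereal (h y)\<bar> \<le> G * n (x - y))"

text \<open>The derivative is taken within \<open>X\<close>.  If \<open>X\<close> has empty interior the gradient is then not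
  unique, but for \<open>x, y \<in> X\<close> the number \<open>grad y \<bullet> (x - y)\<close> is.\<close>

definition gradient_on :: "'a::euclidean_space set \<Rightarrow> ('a \<Rightarrow> real) \<Rightarrow> ('a \<Rightarrow> 'a) \<Rightarrow> bool" where
  "gradient_on X \<psi> grad \<longleftrightarrow> (\<forall>x\<in>X. (\<psi> has_derivative (\<lambda>h. grad x \<bullet> h)) (at x within X))"

definition strongly_convex_1 ::
    "('a::euclidean_space \<Rightarrow> real) \<Rightarrow> 'a set \<Rightarrow> ('a \<Rightarrow> real) \<Rightarrow> ('a \<Rightarrow> 'a) \<Rightarrow> bool" where
  "strongly_convex_1 n X \<psi> grad \<longleftrightarrow>
     (\<forall>x\<in>X. \<forall>y\<in>X. \<psi> y \<ge> \<psi> x + grad x \<bullet> (y - x) + (n (x - y))\<^sup>2 / 2)"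

definition bregman :: "('a::euclidean_space \<Rightarrow> real) \<Rightarrow> ('a \<Rightarrow> 'a) \<Rightarrow> 'a \<Rightarrow> 'a \<Rightarrow> real" where
  "bregman \<psi> grad x y = \<psi> x - \<psi> y - grad y \<bullet> (x - y)"

text \<open>One sample path of ergodic mirror descent, indexed from 1: \<open>g\<close> is the subgradient selection,
  \<open>\<xi>\<close> the realised samples and \<open>x\<close> the iterates.  The minimiser is unique when \<open>\<psi>\<close> is
  strongly convex.\<close>

definition emd_path :: "'a::euclidean_space set \<Rightarrow> ('a \<Rightarrow> real) \<Rightarrow> ('a \<Rightarrow> 'a) \<Rightarrow> (nat \<Rightarrow> real)
    \<Rightarrow> ('a \<Rightarrow> 'x \<Rightarrow> 'a) \<Rightarrow> (nat \<Rightarrow> 'x) \<Rightarrow> (nat \<Rightarrow> 'a) \<Rightarrow> bool" where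
  "emd_path X \<psi> grad \<alpha> g \<xi> x \<longleftrightarrow>
     (\<forall>t\<ge>1. is_arg_min (\<lambda>z. g (x t) (\<xi> t) \<bullet> z + bregman \<psi> grad z (x t) / \<alpha> t)
              (\<lambda>z. z \<in> X) (x (Suc t)))"

text \<open>The distances are computed from densities with respect to the dominating measure
  \<open>Q\<^sub>1 + Q\<^sub>2\<close>.  The lemmas \<open>d_TV_density\<close> and \<open>d_hel_density\<close> show that every other choice
  of dominating measure gives the same value.\<close>

definition sum_measure :: "'x measure \<Rightarrow> 'x measure \<Rightarrow> 'x measure" where
  "sum_measure Q1 Q2 = measure_of (space Q1) (sets Q1) (\<lambda>A. emeasure Q1 A + emeasure Q2 A)"

definition sum_density :: "'x measure \<Rightarrow> 'x measure \<Rightarrow> 'x measure \<Rightarrow> 'x \<Rightarrow> real" where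
  "sum_density Q1 Q2 Q = (\<lambda>x. enn2real (RN_deriv (sum_measure Q1 Q2) Q x))"

definition d_TV :: "'x measure \<Rightarrow> 'x measure \<Rightarrow> real" where
  "d_TV Q1 Q2 =
     (\<integral>x. \<bar>sum_density Q1 Q2 Q1 x - sum_density Q1 Q2 Q2 x\<bar> \<partial>sum_measure Q1 Q2)"

definition d_hel :: "'x measure \<Rightarrow> 'x measure \<Rightarrow> real" where
  "d_hel Q1 Q2 =
     sqrt (\<integral>x. (sqrt (sum_density Q1 Q2 Q1 x) - sqrt (sum_density Q1 Q2 Q2 x))\<^sup>2 \<partial>sum_measure Q1 Q2)"

lemma sets_sum_measure [simp, measurable_cong]: "sets (sum_measure Q1 Q2) = sets Q1"
  by (simp add: sum_measure_def sets.sigma_sets_eq)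

lemma emeasure_sum_measure:
  assumes "sets Q2 = sets Q1" "A \<in> sets Q1"
  shows "emeasure (sum_measure Q1 Q2) A = emeasure Q1 A + emeasure Q2 A"
proof (rule emeasure_measure_of[OF sum_measure_def])
  show "sets Q1 \<subseteq> Pow (space Q1)" by (rule sets.space_closed)
  show "positive (sets (sum_measure Q1 Q2)) (\<lambda>A. emeasure Q1 A + emeasure Q2 A)"
    by (simp add: positive_def)
  show "countably_additive (sets (sum_measure Q1 Q2)) (\<lambda>A. emeasure Q1 A + emeasure Q2 A)"
    using assms(1) by (auto simp: countably_additive_def suminf_add[symmetric] suminf_emeasure)
  show "A \<in> sets (sum_measure Q1 Q2)" using assms(2) by simp
qed

lemma sum_density_density:
  fixes q1 q2 :: "'x \<Rightarrow> real"
  assumes q [measurable]: "q1 \<in> borel_measurable \<mu>" "q2 \<in> borel_measurable \<mu>"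
    and nn: "\<And>x. 0 \<le> q1 x" "\<And>x. 0 \<le> q2 x"
    and Q: "Q1 = density \<mu> q1" "Q2 = density \<mu> q2"
    and prob: "prob_space Q1" "prob_space Q2"
  shows "sum_measure Q1 Q2 = density \<mu> (\<lambda>x. q1 x + q2 x)"
    and "AE x in \<mu>. (q1 x + q2 x) * sum_density Q1 Q2 Q1 x = q1 x"
    and "AE x in \<mu>. (q1 x + q2 x) * sum_density Q1 Q2 Q2 x = q2 x"
proof -
  have sQ [simp]: "sets Q1 = sets \<mu>" "sets Q2 = sets \<mu>" by (simp_all add: Q)
  show eq: "sum_measure Q1 Q2 = density \<mu> (\<lambda>x. q1 x + q2 x)"
  proof (rule measure_eqI)
    fix A assume "A \<in> sets (sum_measure Q1 Q2)"
    then have A [measurable]: "A \<in> sets \<mu>" by simp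
    show "emeasure (sum_measure Q1 Q2) A = emeasure (density \<mu> (\<lambda>x. q1 x + q2 x)) A"
      using nn A by (simp add: emeasure_sum_measure, simp add: Q emeasure_density
          nn_integral_add[symmetric] ennreal_plus distrib_right)
  qed simp
  have *: "AE x in \<mu>. (q1 x + q2 x) * sum_density Q1 Q2 Q x = q x"
    if [measurable]: "q \<in> borel_measurable \<mu>" and qnn: "\<And>x. 0 \<le> q x" and le: "\<And>x. q x \<le> q1 x + q2 x"
      and Qq: "Q = density \<mu> q" and pQ: "prob_space Q" for Q q
  proof -
    interpret Q1: prob_space Q1 by fact
    interpret Q2: prob_space Q2 by fact
    interpret S: finite_measure "sum_measure Q1 Q2"
      by (rule finite_measureI)
        (metis Q1.emeasure_finite Q2.emeasure_finite emeasure_sum_measure ennreal_add_eq_top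
          infinity_ennreal_def sets.top sets_eq_imp_space_eq sets_sum_measure sQ)
    define r where "r = RN_deriv (sum_measure Q1 Q2) Q"
    have sr: "sets (sum_measure Q1 Q2) = sets \<mu>" by simp
    have r [measurable]: "r \<in> borel_measurable \<mu>"
      using borel_measurable_RN_deriv[of "sum_measure Q1 Q2" Q] sr
      unfolding r_def by (metis measurable_cong_sets)
    have "absolutely_continuous (sum_measure Q1 Q2) Q"
      unfolding eq Qq absolutely_continuous_def
    proof
      fix N assume "N \<in> null_sets (density \<mu> (\<lambda>x. ennreal (q1 x + q2 x)))"
      then have N: "N \<in> sets \<mu>" and ae: "AE x in \<mu>. x \<in> N \<longrightarrow> ennreal (q1 x + q2 x) = 0"
        by (auto simp: null_sets_density_iff)
      from ae have "AE x in \<mu>. x \<in> N \<longrightarrow> ennreal (q x) = 0"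
      proof eventually_elim
        case (elim x) then show ?case using le[of x] qnn[of x]
          by (auto simp: ennreal_eq_0_iff)
      qed
      then show "N \<in> null_sets (density \<mu> q)" using N by (simp add: null_sets_density_iff)
    qed
    moreover have "sets Q = sets (sum_measure Q1 Q2)" by (simp add: Qq)
    ultimately have "density (sum_measure Q1 Q2) r = Q"
      unfolding r_def by (rule S.density_RN_deriv)
    then have "density \<mu> (\<lambda>x. ennreal (q1 x + q2 x) * r x) = density \<mu> q"
      unfolding eq Qq by (subst (asm) density_density_eq) auto
    moreover have "sigma_finite_measure (density \<mu> q)"
      using pQ unfolding Qq by (simp add: prob_space_imp_sigma_finite)
    ultimately have "AE x in \<mu>. ennreal (q x) = ennreal (q1 x + q2 x) * r x"
      by (subst sigma_finite_density_unique[symmetric]) auto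
    then show ?thesis
    proof eventually_elim
      case (elim x)
      then have "enn2real (ennreal (q x)) = enn2real (ennreal (q1 x + q2 x) * r x)" by simp
      then show ?case using qnn[of x] nn[of x]
        by (simp add: sum_density_def r_def enn2real_mult del: ennreal_plus)
    qed
  qed
  show "AE x in \<mu>. (q1 x + q2 x) * sum_density Q1 Q2 Q1 x = q1 x"
    by (rule *) (use nn Q prob in auto)
  show "AE x in \<mu>. (q1 x + q2 x) * sum_density Q1 Q2 Q2 x = q2 x"
    by (rule *) (use nn Q prob in auto)
qed

lemma sum_density_measurable:
  assumes "sets Q1 = sets \<mu>"
  shows "sum_density Q1 Q2 Q \<in> borel_measurable \<mu>"
proof -
  have "sum_density Q1 Q2 Q \<in> borel_measurable (sum_measure Q1 Q2)"
    unfolding sum_density_def by measurable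
  then show ?thesis using assms by (simp cong: measurable_cong_sets)
qed

lemma d_TV_density:
  fixes q1 q2 :: "'x \<Rightarrow> real"
  assumes q [measurable]: "q1 \<in> borel_measurable \<mu>" "q2 \<in> borel_measurable \<mu>"
    and nn: "\<And>x. 0 \<le> q1 x" "\<And>x. 0 \<le> q2 x"
    and Q: "Q1 = density \<mu> q1" "Q2 = density \<mu> q2"
    and prob: "prob_space Q1" "prob_space Q2"
  shows "d_TV Q1 Q2 = (\<integral>x. \<bar>q1 x - q2 x\<bar> \<partial>\<mu>)"
proof -
  note S = sum_density_density[OF assms]
  have [measurable]: "sum_density Q1 Q2 Q \<in> borel_measurable \<mu>" for Q
    by (rule sum_density_measurable) (simp add: Q)
  have "d_TV Q1 Q2 =
      (\<integral>x. (q1 x + q2 x) * \<bar>sum_density Q1 Q2 Q1 x - sum_density Q1 Q2 Q2 x\<bar> \<partial>\<mu>)"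
    unfolding d_TV_def S(1) using nn by (subst integral_real_density) auto
  also have "\<dots> = (\<integral>x. \<bar>q1 x - q2 x\<bar> \<partial>\<mu>)"
  proof (rule integral_cong_AE)
    show "AE x in \<mu>. (q1 x + q2 x) * \<bar>sum_density Q1 Q2 Q1 x - sum_density Q1 Q2 Q2 x\<bar>
        = \<bar>q1 x - q2 x\<bar>"
      using S(2,3)
    proof eventually_elim
      case (elim x)
      have "(q1 x + q2 x) * \<bar>sum_density Q1 Q2 Q1 x - sum_density Q1 Q2 Q2 x\<bar>
          = \<bar>(q1 x + q2 x) * (sum_density Q1 Q2 Q1 x - sum_density Q1 Q2 Q2 x)\<bar>"
        using nn[of x] by (simp add: abs_mult)
      then show ?case using elim by (simp add: right_diff_distrib)
    qed
  qed auto
  finally show ?thesis .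
qed

lemma d_hel_density:
  fixes q1 q2 :: "'x \<Rightarrow> real"
  assumes q [measurable]: "q1 \<in> borel_measurable \<mu>" "q2 \<in> borel_measurable \<mu>"
    and nn: "\<And>x. 0 \<le> q1 x" "\<And>x. 0 \<le> q2 x"
    and Q: "Q1 = density \<mu> q1" "Q2 = density \<mu> q2"
    and prob: "prob_space Q1" "prob_space Q2"
  shows "(d_hel Q1 Q2)\<^sup>2 = (\<integral>x. (sqrt (q1 x) - sqrt (q2 x))\<^sup>2 \<partial>\<mu>)"
proof -
  note S = sum_density_density[OF assms]
  have [measurable]: "sum_density Q1 Q2 Q \<in> borel_measurable \<mu>" for Q
    by (rule sum_density_measurable) (simp add: Q)
  have "(d_hel Q1 Q2)\<^sup>2 = (\<integral>x. (q1 x + q2 x) *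
      (sqrt (sum_density Q1 Q2 Q1 x) - sqrt (sum_density Q1 Q2 Q2 x))\<^sup>2 \<partial>\<mu>)"
    unfolding d_hel_def
    by (subst real_sqrt_pow2, simp) (unfold S(1), use nn in \<open>subst integral_real_density\<close>, auto)
  also have "\<dots> = (\<integral>x. (sqrt (q1 x) - sqrt (q2 x))\<^sup>2 \<partial>\<mu>)"
  proof (rule integral_cong_AE)
    show "AE x in \<mu>. (q1 x + q2 x) *
        (sqrt (sum_density Q1 Q2 Q1 x) - sqrt (sum_density Q1 Q2 Q2 x))\<^sup>2
        = (sqrt (q1 x) - sqrt (q2 x))\<^sup>2"
      using S(2,3)
    proof eventually_elim
      case (elim x)
      have "(q1 x + q2 x) * (sqrt (sum_density Q1 Q2 Q1 x) - sqrt (sum_density Q1 Q2 Q2 x))\<^sup>2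
          = (sqrt (q1 x + q2 x) * (sqrt (sum_density Q1 Q2 Q1 x) - sqrt (sum_density Q1 Q2 Q2 x)))\<^sup>2"
        using nn[of x] by (simp add: power_mult_distrib)
      also have "\<dots> = (sqrt ((q1 x + q2 x) * sum_density Q1 Q2 Q1 x)
          - sqrt ((q1 x + q2 x) * sum_density Q1 Q2 Q2 x))\<^sup>2"
        by (simp add: right_diff_distrib real_sqrt_mult)
      finally show ?case using elim by simp
    qed
  qed auto
  finally show ?thesis .
qed

text \<open>The \<open>\<sigma>\<close>-algebra generated by \<open>\<xi> 1, \<dots>, \<xi> s\<close>; it is trivial for \<open>s = 0\<close>.\<close>

definition past :: "'w measure \<Rightarrow> 'x measure \<Rightarrow> (nat \<Rightarrow> 'w \<Rightarrow> 'x) \<Rightarrow> nat \<Rightarrow> 'w measure" where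
  "past M \<pi> \<xi> s =
     sigma (space M) {\<xi> i -` A \<inter> space M |i A. i \<in> {1..s} \<and> A \<in> sets \<pi>}"

text \<open>\<open>K\<close> is a regular version of the conditional distribution of \<open>Y\<close> given the
  \<open>\<sigma>\<close>-algebra \<open>H\<close>.\<close>

definition cond_distribution ::
    "'w measure \<Rightarrow> 'w measure \<Rightarrow> 'x measure \<Rightarrow> ('w \<Rightarrow> 'x) \<Rightarrow> ('w \<Rightarrow> 'x measure) \<Rightarrow> bool" where
  "cond_distribution M H S Y K \<longleftrightarrow>
     K \<in> H \<rightarrow>\<^sub>M prob_algebra S \<and>
     (\<forall>A\<in>sets S. AE \<omega> in M.
        real_cond_exp M H (\<lambda>\<omega>. indicator A (Y \<omega>)) \<omega> = measure (K \<omega>) A)"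

text \<open>\<open>K s t \<omega>\<close> stands for the law of \<open>\<xi> t\<close> given the first \<open>s\<close> samples.  Mixing times are at
  least 1 and are infinite if no \<open>t\<close> qualifies.\<close>

definition mixing_time :: "('x measure \<Rightarrow> 'x measure \<Rightarrow> real) \<Rightarrow> 'x measure
    \<Rightarrow> (nat \<Rightarrow> nat \<Rightarrow> 'w \<Rightarrow> 'x measure) \<Rightarrow> nat \<Rightarrow> real \<Rightarrow> 'w \<Rightarrow> enat" where
  "mixing_time d \<pi> K s \<epsilon> \<omega> =
     (INF t\<in>{t. 1 \<le> t \<and> d (K s (s + t) \<omega>) \<pi> \<le> \<epsilon>}. enat t)"

definition uniform_mixing :: "'w measure \<Rightarrow> 'x measure \<Rightarrow> (nat \<Rightarrow> nat \<Rightarrow> 'w \<Rightarrow> 'x measure)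
    \<Rightarrow> (real \<Rightarrow> nat) \<Rightarrow> (real \<Rightarrow> nat) \<Rightarrow> bool" where
  "uniform_mixing M \<pi> K \<tau>TV \<tau>hel \<longleftrightarrow>
     (AE \<omega> in M. \<forall>\<epsilon>>0. \<forall>s. mixing_time d_TV \<pi> K s \<epsilon> \<omega> \<le> enat (\<tau>TV \<epsilon>)
        \<and> mixing_time d_hel \<pi> K s \<epsilon> \<omega> \<le> enat (\<tau>hel \<epsilon>))"

text \<open>For a process that is not a homogeneous Markov chain the distance of \<open>K s (s + t) \<omega>\<close> to
  \<open>\<pi>\<close> need not decrease in \<open>t\<close>, so a bound on the first time at which it is at most \<open>\<epsilon>\<close> says nothing
  about the lag \<open>\<tau>TV \<epsilon>\<close> itself.  The next predicate states that the process is mixed up to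
  \<open>\<epsilon>\<close> at that lag.\<close>

definition mixed_at_lag :: "'w measure \<Rightarrow> 'x measure \<Rightarrow> (nat \<Rightarrow> nat \<Rightarrow> 'w \<Rightarrow> 'x measure)
    \<Rightarrow> (real \<Rightarrow> nat) \<Rightarrow> bool" where
  "mixed_at_lag M \<pi> K \<tau>TV \<longleftrightarrow>
     (AE \<omega> in M. \<forall>\<epsilon>>0. \<forall>s. d_TV (K s (s + \<tau>TV \<epsilon>) \<omega>) \<pi> \<le> \<epsilon>)"

text \<open>A Lipschitz bound over \<open>X\<close> for \<open>\<pi>\<close>-almost every sample controls neither the selected
  subgradients at relative boundary points of \<open>X\<close> nor the samples that the process can draw from a
  \<open>\<pi>\<close>-null set.  The next predicate bounds the subgradients along the process.\<close>

definition subgradients_bounded :: "'w measure \<Rightarrow> (nat \<Rightarrow> 'w \<Rightarrow> 'x) \<Rightarrow> ('a::euclidean_space \<Rightarrow> real)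
    \<Rightarrow> real \<Rightarrow> 'a set \<Rightarrow> ('a \<Rightarrow> 'x \<Rightarrow> 'a) \<Rightarrow> bool" where
  "subgradients_bounded M \<xi> n G X g \<longleftrightarrow>
     (AE \<omega> in M. \<forall>t\<ge>1. \<forall>x\<in>X. dual_norm n (g x (\<xi> t \<omega>)) \<le> G)"

end

theory Submission
  imports Defs
begin

text \<open>With \<open>k = \<tau>TV \<epsilon>\<close>, the gap \<open>f (x t) - f xstar\<close> is compared with the loss on the sample drawn
  \<open>k\<close> steps after the last one that \<open>x t\<close> depends on.  Its conditional law is within \<open>\<epsilon>\<close> of \<open>\<pi>\<close>, so
  up to \<open>\<epsilon> G R\<close> the difference is noise with conditional mean zero, and Azuma's inequality applies to
  each of the \<open>k\<close> interleaved subsequences.  Evaluating that loss at the current iterate instead costs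
  \<open>(k - 1) G\<^sup>2 \<alpha> t\<close>, because one step moves by at most \<open>G \<alpha> t\<close>, and the remaining sum is the regret of
  online mirror descent.

  The event quantifies over all \<open>\<epsilon>\<close> at once, but this needs no union bound: the right-hand sides
  are deterministic, so the events for different \<open>\<epsilon>\<close> are nested and the probability bound passes to
  their infimum.\<close>

text \<open>Strong convexity turns the Bregman bound into a diameter bound,
  \<open>n (y - z) \<le> R\<close>, so a \<open>G\<close>-Lipschitz loss varies by at most
  \<open>G * R\<close> over \<open>X\<close>. Since \<open>d_TV\<close> is the full L1 distance of
  densities, a function bounded by \<open>G * R\<close> changes its mean by at most
  \<open>\<epsilon> * (G * R)\<close>, without a factor 2. For the last \<open>k - 1\<close>
  iterates the delayed sample lies beyond time \<open>T\<close>; each is charged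
  \<open>G * R\<close>, which is where the term \<open>(k - 1) * (G * R)\<close> originates.

  The obstacle is measure-theoretic. The iterates are known only as pathwise minimisers, neither
  \<open>grad\<close> nor the joint dependence of \<open>F\<close> on point and sample is assumed
  measurable, and conditional laws are specified one event at a time. Before the noise can be shown
  to be centred, the iterates have to be adapted, loss differences jointly measurable, and the
  kernels able to integrate functions that also depend on the path. Quadratic growth of the step
  objective, difference quotients of \<open>\<psi>\<close> and Riemann sums of subgradients give the
  measurability; a joint law determined by rectangles gives the kernel rule.\<close>

section \<open>Norms\<close>

lemma is_norm_zero: "is_norm n \<Longrightarrow> n 0 = 0"
  by (simp add: is_norm_def)

lemma is_norm_continuous:
  fixes n :: "'a::euclidean_space \<Rightarrow> real"
  assumes n: "is_norm n"
  shows "continuous_on UNIV n"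
proof -
  have tri: "n (x + y) \<le> n x + n y" and hom: "n (a *\<^sub>R x) = \<bar>a\<bar> * n x" for x y a
    using n by (auto simp: is_norm_def)
  have "convex_on UNIV n"
  proof (rule convex_onI)
    fix t :: real and x y :: 'a assume "0 < t" "t < 1"
    then show "n ((1 - t) *\<^sub>R x + t *\<^sub>R y) \<le> (1 - t) * n x + t * n y"
      using tri[of "(1 - t) *\<^sub>R x" "t *\<^sub>R y"] by (simp add: hom)
  qed simp
  then show ?thesis by (intro convex_on_continuous) auto
qed

text \<open>Compactness of the Euclidean unit sphere gives \<open>n\<close> a positive minimum
  there, and homogeneity spreads it to all vectors. The bound makes the supremum in
  \<open>dual_norm\<close> finite and converts growth measured by \<open>n\<close> into Euclidean
  growth.\<close>

lemma is_norm_lower_bound: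
  fixes n :: "'a::euclidean_space \<Rightarrow> real"
  assumes n: "is_norm n"
  obtains c where "0 < c" "\<And>x. c * norm x \<le> n x"
proof -
  have hom: "n (a *\<^sub>R x) = \<bar>a\<bar> * n x" and pos: "n x = 0 \<longleftrightarrow> x = 0" "0 \<le> n x" for x a
    using n by (auto simp: is_norm_def)
  have cont: "continuous_on (sphere 0 1) n"
    using is_norm_continuous[OF n] by (rule continuous_on_subset) simp
  obtain b :: 'a where b: "b \<in> Basis" using nonempty_Basis by blast
  then have "sphere (0::'a) 1 \<noteq> {}" by (auto simp: sphere_def dist_norm intro!: exI[of _ b])
  then obtain u where u: "u \<in> sphere 0 1" "\<And>y. y \<in> sphere 0 1 \<Longrightarrow> n u \<le> n y"
    using continuous_attains_inf[OF compact_sphere _ cont] by blast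
  show thesis
  proof
    have "u \<noteq> 0" using u(1) by auto
    then show "0 < n u" using pos[of u] by (simp add: less_le)
    fix x :: 'a
    show "n u * norm x \<le> n x"
    proof (cases "x = 0")
      case False
      have "n u \<le> n ((1 / norm x) *\<^sub>R x)" by (rule u(2)) (use False in simp)
      also have "\<dots> = n x / norm x" by (simp add: hom)
      finally show ?thesis using False by (simp add: field_simps)
    qed (simp add: pos)
  qed
qed

lemma inner_le_dual_norm:
  fixes n :: "'a::euclidean_space \<Rightarrow> real"
  assumes n: "is_norm n"
  shows "g \<bullet> v \<le> dual_norm n g * n v"
proof (cases "v = 0")
  case True
  then show ?thesis by (simp add: is_norm_zero[OF n])
next
  case False
  then have nv: "0 < n v" using n by (auto simp: is_norm_def less_le)
  obtain c where c: "0 < c" "\<And>x. c * norm x \<le> n x" by (rule is_norm_lower_bound[OF n]) blast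
  \<comment> \<open>A real-valued \<open>SUP\<close> carries information only for sets that are
    bounded above, so finiteness of the dual norm has to come first.\<close>
  have "bdd_above ((\<lambda>v. g \<bullet> v) ` {v. n v \<le> 1})"
  proof (rule bdd_aboveI2)
    fix w assume "w \<in> {v. n v \<le> 1}"
    then have "c * norm w \<le> 1" using c(2)[of w] by simp
    then have w: "norm w \<le> 1 / c" using c(1) by (simp add: field_simps)
    have "g \<bullet> w \<le> norm g * norm w" by (rule norm_cauchy_schwarz)
    also have "\<dots> \<le> norm g * (1 / c)" by (intro mult_left_mono w) simp
    finally show "g \<bullet> w \<le> norm g * (1 / c)" .
  qed
  moreover have "n ((1 / n v) *\<^sub>R v) = \<bar>1 / n v\<bar> * n v"
    using n by (simp only: is_norm_def)
  then have "(1 / n v) *\<^sub>R v \<in> {v. n v \<le> 1}" using nv by simp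
  ultimately have "g \<bullet> ((1 / n v) *\<^sub>R v) \<le> dual_norm n g"
    unfolding dual_norm_def by (intro cSUP_upper)
  then show ?thesis using nv by (simp add: field_simps)
qed

section \<open>Total variation and regular conditional distributions\<close>

text \<open>Both measures have densities with respect to their sum, so the difference of the
  integrals is the integral of \<open>\<phi>\<close> against the difference of the
  densities.\<close>

lemma integral_diff_le_d_TV:
  assumes prob: "prob_space Q1" "prob_space Q2" and sets: "sets Q2 = sets Q1"
    and \<phi>: "\<phi> \<in> borel_measurable Q1" "\<And>x. x \<in> space Q1 \<Longrightarrow> \<bar>\<phi> x\<bar> \<le> c"
  shows "\<bar>(\<integral>x. \<phi> x \<partial>Q1) - (\<integral>x. \<phi> x \<partial>Q2)\<bar> \<le> c * d_TV Q1 Q2"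
proof -
  interpret Q1: prob_space Q1 by fact
  interpret Q2: prob_space Q2 by fact
  define S where "S = sum_measure Q1 Q2"
  have sS[measurable_cong]: "sets S = sets Q1" by (simp add: S_def)
  then have spS: "space S = space Q1" by (rule sets_eq_imp_space_eq)
  have eS: "emeasure S A = emeasure Q1 A + emeasure Q2 A" if "A \<in> sets Q1" for A
    unfolding S_def by (rule emeasure_sum_measure[OF sets that])
  interpret S: finite_measure S
    by (rule finite_measureI) (simp add: spS eS Q1.emeasure_eq_measure Q2.emeasure_eq_measure)
  define q where "q Q = sum_density Q1 Q2 Q" for Q
  have q_meas[measurable]: "q Q \<in> borel_measurable S" for Q
    unfolding q_def sum_density_def S_def by measurable
  have q_nn: "0 \<le> q Q x" for Q x by (simp add: q_def sum_density_def)
  have dens: "Q = density S (q Q)"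
    if Q: "prob_space Q" "sets Q = sets Q1" "\<And>A. A \<in> sets Q1 \<Longrightarrow> emeasure Q A \<le> emeasure S A" for Q
  proof -
    interpret Q: prob_space Q by fact
    have "absolutely_continuous S Q"
      unfolding absolutely_continuous_def using Q(2,3) by (fastforce simp: null_sets_def sS)
    then have d: "density S (RN_deriv S Q) = Q" by (rule S.density_RN_deriv) (simp add: sS Q)
    \<comment> \<open>\<open>sum_density\<close> sends the value infinity to 0. The derivative of a
      probability measure is finite almost everywhere, so nothing is lost.\<close>
    have "AE x in S. RN_deriv S Q x \<noteq> \<infinity>"
    proof (rule nn_integral_PInf_AE)
      have "emeasure Q (space S) = (\<integral>\<^sup>+x. RN_deriv S Q x * indicator (space S) x \<partial>S)"
        by (subst d[symmetric], rule emeasure_density) auto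
      also have "\<dots> = (\<integral>\<^sup>+x. RN_deriv S Q x \<partial>S)" by (rule nn_integral_cong) simp
      finally show "(\<integral>\<^sup>+x. RN_deriv S Q x \<partial>S) \<noteq> \<infinity>"
        by (metis Q.emeasure_finite infinity_ennreal_def)
    qed simp
    then have "AE x in S. RN_deriv S Q x = ennreal (q Q x)"
      by eventually_elim (simp add: q_def sum_density_def S_def[symmetric] less_top)
    then have "density S (RN_deriv S Q) = density S (q Q)" by (intro density_cong) auto
    then show ?thesis using d by simp
  qed
  have d1: "Q1 = density S (q Q1)" by (rule dens[OF prob(1)]) (simp_all add: eS)
  have d2: "Q2 = density S (q Q2)" by (rule dens[OF prob(2) sets]) (simp add: eS)
  have \<phi>S[measurable]: "\<phi> \<in> borel_measurable S" using \<phi>(1) by measurable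
  have \<phi>S2: "\<phi> \<in> borel_measurable Q2" using \<phi>(1) sets by (simp cong: measurable_cong_sets)
  have sp2: "space Q2 = space Q1" using sets by (rule sets_eq_imp_space_eq)
  have int1: "integrable Q1 \<phi>" by (rule Q1.integrable_const_bound[of _ c]) (use \<phi> in auto)
  have int2: "integrable Q2 \<phi>"
    by (rule Q2.integrable_const_bound[of _ c]) (use \<phi> sp2 \<phi>S2 in auto)
  have i1: "integrable S (\<lambda>x. q Q1 x * \<phi> x)"
    using int1 by (subst (asm) d1, subst (asm) integrable_density) (auto simp: q_nn)
  have i2: "integrable S (\<lambda>x. q Q2 x * \<phi> x)"
    using int2 by (subst (asm) d2, subst (asm) integrable_density) (auto simp: q_nn)
  have j1: "integrable S (q Q1)"
    using integrable_density[of "\<lambda>_. 1::real" S "q Q1"] q_nn d1[symmetric] by simp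
  have j2: "integrable S (q Q2)"
    using integrable_density[of "\<lambda>_. 1::real" S "q Q2"] q_nn d2[symmetric] by simp
  have e1: "(\<integral>x. \<phi> x \<partial>Q1) = (\<integral>x. q Q1 x * \<phi> x \<partial>S)"
    by (subst d1, subst integral_density) (auto simp: q_nn)
  have e2: "(\<integral>x. \<phi> x \<partial>Q2) = (\<integral>x. q Q2 x * \<phi> x \<partial>S)"
    by (subst d2, subst integral_density) (auto simp: q_nn)
  have "(\<integral>x. \<phi> x \<partial>Q1) - (\<integral>x. \<phi> x \<partial>Q2) = (\<integral>x. (q Q1 x - q Q2 x) * \<phi> x \<partial>S)"
    unfolding e1 e2 using i1 i2 by (simp add: left_diff_distrib)
  also have "\<bar>\<dots>\<bar> \<le> (\<integral>x. \<bar>(q Q1 x - q Q2 x) * \<phi> x\<bar> \<partial>S)"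
    by (rule integral_abs_bound)
  also have "\<dots> \<le> (\<integral>x. c * \<bar>q Q1 x - q Q2 x\<bar> \<partial>S)"
  proof (rule integral_mono)
    show "integrable S (\<lambda>x. \<bar>(q Q1 x - q Q2 x) * \<phi> x\<bar>)"
      using i1 i2 by (simp add: left_diff_distrib)
    show "integrable S (\<lambda>x. c * \<bar>q Q1 x - q Q2 x\<bar>)" using j1 j2 by simp
    fix x assume "x \<in> space S"
    then have "\<bar>\<phi> x\<bar> \<le> c" using \<phi>(2) spS by simp
    then show "\<bar>(q Q1 x - q Q2 x) * \<phi> x\<bar> \<le> c * \<bar>q Q1 x - q Q2 x\<bar>"
      by (simp add: abs_mult mult.commute[of c] mult_left_mono)
  qed
  also have "\<dots> = c * d_TV Q1 Q2" by (simp add: d_TV_def q_def S_def)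
  finally show ?thesis .
qed

context
  fixes M H :: "'w measure" and S :: "'x measure" and Y :: "'w \<Rightarrow> 'x" and K :: "'w \<Rightarrow> 'x measure"
  assumes M: "prob_space M" and sub: "subalgebra M H" and Y [measurable]: "Y \<in> M \<rightarrow>\<^sub>M S"
    and cond: "cond_distribution M H S Y K"
begin

lemma cond_distribution_kernel:
  "K \<in> H \<rightarrow>\<^sub>M subprob_algebra S"
  using cond by (simp add: cond_distribution_def measurable_prob_algebraD)

lemma cond_distribution_prob_space:
  assumes "\<omega> \<in> space M"
  shows "prob_space (K \<omega>)" "sets (K \<omega>) = sets S" "space (K \<omega>) = space S"
proof -
  have "K \<omega> \<in> space (prob_algebra S)"
    using cond sub assms by (intro measurable_space[of K H]) (auto simp: cond_distribution_def subalgebra_def)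
  then show "prob_space (K \<omega>)" "sets (K \<omega>) = sets S" by (auto simp: space_prob_algebra)
  then show "space (K \<omega>) = space S" by (auto dest: sets_eq_imp_space_eq)
qed

text \<open>\<open>cond_distribution\<close> speaks of one set at a time, each with its own null
  set. On a rectangle \<open>a \<times> b\<close> it says that integrating
  \<open>measure (K \<omega>) b\<close> over \<open>a\<close> gives the joint probability, and
  rectangles form an intersection-stable generator. The outer measure is \<open>M\<close> restricted
  to \<open>H\<close> because \<open>K\<close> is known to be measurable only with respect to
  \<open>H\<close>.\<close>

lemma cond_distribution_joint:
  "distr M (H \<Otimes>\<^sub>M S) (\<lambda>\<omega>. (\<omega>, Y \<omega>))
     = restr_to_subalg M H \<bind> (\<lambda>\<omega>. distr (K \<omega>) (H \<Otimes>\<^sub>M S) (Pair \<omega>))"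
proof -
  interpret prob_space M by fact
  interpret sigma_finite_subalgebra M H
    by (rule finite_measure_subalgebra_is_sigma_finite)
      (simp add: finite_measure_subalgebra_def finite_measure_subalgebra_axioms_def finite_measure_axioms sub)
  define R where "R = restr_to_subalg M H"
  have spH: "space H = space M" using sub by (simp add: subalgebra_def)
  have [measurable_cong]: "sets R = sets H" unfolding R_def by (rule sets_restr_to_subalg[OF sub])
  have spR: "space R = space M" by (simp add: R_def space_restr_to_subalg)
  note [measurable] = cond_distribution_kernel
  have ker[measurable]: "(\<lambda>\<omega>. distr (K \<omega>) (H \<Otimes>\<^sub>M S) (Pair \<omega>)) \<in> R \<rightarrow>\<^sub>M subprob_algebra (H \<Otimes>\<^sub>M S)"
    by (rule measurable_distr2[where M = S]) measurable
  have id[measurable]: "(\<lambda>\<omega>. \<omega>) \<in> M \<rightarrow>\<^sub>M H"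
    using sub by (auto simp: measurable_def subalgebra_def intro: sets.Int_space_eq2[THEN ssubst])
  show ?thesis unfolding R_def[symmetric]
  proof (rule measure_eqI_generator_eq[OF Int_stable_pair_measure_generator[of H S]])
    show "{a \<times> b |a b. a \<in> sets H \<and> b \<in> sets S} \<subseteq> Pow (space H \<times> space S)"
      by (auto dest: sets.sets_into_space)
    show "sets (distr M (H \<Otimes>\<^sub>M S) (\<lambda>\<omega>. (\<omega>, Y \<omega>)))
        = sigma_sets (space H \<times> space S) {a \<times> b |a b. a \<in> sets H \<and> b \<in> sets S}"
      by (simp add: sets_pair_measure)
    show "sets (R \<bind> (\<lambda>\<omega>. distr (K \<omega>) (H \<Otimes>\<^sub>M S) (Pair \<omega>)))
        = sigma_sets (space H \<times> space S) {a \<times> b |a b. a \<in> sets H \<and> b \<in> sets S}"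
      by (subst sets_bind[where N = "H \<Otimes>\<^sub>M S"]) (auto simp: sets_pair_measure spR not_empty)
    show "range (\<lambda>i::nat. space H \<times> space S) \<subseteq> {a \<times> b |a b. a \<in> sets H \<and> b \<in> sets S}" by auto
    show "(\<Union>i::nat. space H \<times> space S) = space H \<times> space S" by auto
    have "emeasure (distr M (H \<Otimes>\<^sub>M S) (\<lambda>\<omega>. (\<omega>, Y \<omega>))) A \<le> 1" for A
      by (rule prob_space.emeasure_le_1[OF prob_space_distr]) measurable
    then show "emeasure (distr M (H \<Otimes>\<^sub>M S) (\<lambda>\<omega>. (\<omega>, Y \<omega>))) (space H \<times> space S) \<noteq> \<infinity>" for i :: nat
      by (metis ennreal_one_less_top infinity_ennreal_def not_le)
    fix A assume "A \<in> {a \<times> b |a b. a \<in> sets H \<and> b \<in> sets S}"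
    then obtain a b where A: "A = a \<times> b" and a[measurable]: "a \<in> sets H" and b[measurable]: "b \<in> sets S"
      by auto
    have aM[measurable]: "a \<in> sets M" using a sub by (auto simp: subalgebra_def)
    have Kb: "AE \<omega> in M. real_cond_exp M H (\<lambda>\<omega>. indicator b (Y \<omega>)) \<omega> = measure (K \<omega>) b"
      using cond b by (simp add: cond_distribution_def)
    have [measurable]: "(\<lambda>\<omega>. measure (K \<omega>) b) \<in> borel_measurable H" by measurable
    have KbM[measurable]: "(\<lambda>\<omega>. measure (K \<omega>) b) \<in> borel_measurable M"
      by (rule measurable_from_subalg[OF sub]) measurable
    have int1: "integrable M (\<lambda>\<omega>. indicator a \<omega> * indicator b (Y \<omega>) :: real)"
      by (rule integrable_const_bound[of _ 1]) (auto simp: indicator_def)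
    have "emeasure (distr M (H \<Otimes>\<^sub>M S) (\<lambda>\<omega>. (\<omega>, Y \<omega>))) A
        = emeasure M ((\<lambda>\<omega>. (\<omega>, Y \<omega>)) -` A \<inter> space M)"
      unfolding A by (rule emeasure_distr) measurable
    also have "\<dots> = (\<integral>\<^sup>+\<omega>. indicator ((\<lambda>\<omega>. (\<omega>, Y \<omega>)) -` A \<inter> space M) \<omega> \<partial>M)"
      unfolding A by (rule nn_integral_indicator[symmetric]) measurable
    also have "\<dots> = (\<integral>\<^sup>+\<omega>. ennreal (indicator a \<omega> * indicator b (Y \<omega>)) \<partial>M)"
      by (rule nn_integral_cong) (auto simp: A indicator_def)
    also have "\<dots> = ennreal (\<integral>\<omega>. indicator a \<omega> * indicator b (Y \<omega>) \<partial>M)"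
      by (rule nn_integral_eq_integral[OF int1]) auto
    also have "(\<integral>\<omega>. indicator a \<omega> * indicator b (Y \<omega>) \<partial>M)
        = (\<integral>\<omega>. indicator a \<omega> * real_cond_exp M H (\<lambda>\<omega>. indicator b (Y \<omega>)) \<omega> \<partial>M)"
      by (rule real_cond_exp_intg(2)[symmetric, OF int1]) measurable
    also have "\<dots> = (\<integral>\<omega>. indicator a \<omega> * measure (K \<omega>) b \<partial>M)"
      using Kb by (intro integral_cong_AE) auto
    also have "ennreal \<dots> = (\<integral>\<^sup>+\<omega>. ennreal (indicator a \<omega> * measure (K \<omega>) b) \<partial>M)"
    proof (rule nn_integral_eq_integral[symmetric])
      show "integrable M (\<lambda>\<omega>. indicator a \<omega> * measure (K \<omega>) b)"
        by (rule integrable_const_bound[of _ 1])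
          (auto simp: indicator_def intro!: prob_space.prob_le_1 cond_distribution_prob_space)
    qed auto
    also have "\<dots> = (\<integral>\<^sup>+\<omega>. ennreal (indicator a \<omega> * measure (K \<omega>) b) \<partial>R)"
      unfolding R_def by (rule nn_integral_subalgebra2[OF sub, symmetric]) measurable
    also have "\<dots> = (\<integral>\<^sup>+\<omega>. emeasure (distr (K \<omega>) (H \<Otimes>\<^sub>M S) (Pair \<omega>)) A \<partial>R)"
    proof (rule nn_integral_cong)
      fix \<omega> assume "\<omega> \<in> space R"
      then have \<omega>: "\<omega> \<in> space M" by (simp add: spR)
      interpret K: prob_space "K \<omega>" by (rule cond_distribution_prob_space[OF \<omega>])
      have sK[measurable_cong]: "sets (K \<omega>) = sets S" by (rule cond_distribution_prob_space[OF \<omega>])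
      have [measurable]: "Pair \<omega> \<in> K \<omega> \<rightarrow>\<^sub>M H \<Otimes>\<^sub>M S"
        using \<omega> by (simp add: spH)
      have "emeasure (distr (K \<omega>) (H \<Otimes>\<^sub>M S) (Pair \<omega>)) A = emeasure (K \<omega>) (Pair \<omega> -` A \<inter> space (K \<omega>))"
        unfolding A by (rule emeasure_distr) measurable
      also have "Pair \<omega> -` A \<inter> space (K \<omega>) = (if \<omega> \<in> a then b else {})"
        using sets.sets_into_space[OF b] cond_distribution_prob_space(3)[OF \<omega>] by (auto simp: A)
      finally show "ennreal (indicator a \<omega> * measure (K \<omega>) b) = emeasure (distr (K \<omega>) (H \<Otimes>\<^sub>M S) (Pair \<omega>)) A"
        by (simp add: K.emeasure_eq_measure)
    qed
    also have "\<dots> = emeasure (R \<bind> (\<lambda>\<omega>. distr (K \<omega>) (H \<Otimes>\<^sub>M S) (Pair \<omega>))) A"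
      unfolding A by (rule emeasure_bind[symmetric, where N = "H \<Otimes>\<^sub>M S"]) (auto simp: spR not_empty)
    finally show "emeasure (distr M (H \<Otimes>\<^sub>M S) (\<lambda>\<omega>. (\<omega>, Y \<omega>))) A
        = emeasure (R \<bind> (\<lambda>\<omega>. distr (K \<omega>) (H \<Otimes>\<^sub>M S) (Pair \<omega>))) A" .
  qed
qed

text \<open>The freezing rule: an argument known to \<open>H\<close> is held fixed while
  \<open>Y\<close> is averaged over its conditional law. The application has a two-argument
  \<open>\<Phi>\<close> because the loss is evaluated at an iterate that is itself random.\<close>

lemma cond_distribution_integral:
  fixes \<Phi> :: "'w \<Rightarrow> 'x \<Rightarrow> real"
  assumes \<Phi>[measurable]: "(\<lambda>(\<omega>, s). \<Phi> \<omega> s) \<in> borel_measurable (H \<Otimes>\<^sub>M S)"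
    and bound: "\<And>\<omega> s. \<omega> \<in> space M \<Longrightarrow> s \<in> space S \<Longrightarrow> \<bar>\<Phi> \<omega> s\<bar> \<le> c"
  shows "(\<lambda>\<omega>. \<integral>s. \<Phi> \<omega> s \<partial>K \<omega>) \<in> borel_measurable H"
    and "(\<integral>\<omega>. \<Phi> \<omega> (Y \<omega>) \<partial>M) = (\<integral>\<omega>. (\<integral>s. \<Phi> \<omega> s \<partial>K \<omega>) \<partial>M)"
proof -
  interpret prob_space M by fact
  have spH: "space H = space M" using sub by (simp add: subalgebra_def)
  have id[measurable]: "(\<lambda>\<omega>. \<omega>) \<in> M \<rightarrow>\<^sub>M H"
    using sub by (auto simp: measurable_def subalgebra_def intro: sets.Int_space_eq2[THEN ssubst])
  note [measurable] = cond_distribution_kernel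
  have ker: "(\<lambda>\<omega>. distr (K \<omega>) (H \<Otimes>\<^sub>M S) (Pair \<omega>)) \<in> H \<rightarrow>\<^sub>M subprob_algebra (H \<Otimes>\<^sub>M S)"
    by (rule measurable_distr2[where M = S]) measurable
  have Pair[measurable]: "Pair \<omega> \<in> K \<omega> \<rightarrow>\<^sub>M H \<Otimes>\<^sub>M S" if "\<omega> \<in> space M" for \<omega>
    using that by (simp add: spH cond_distribution_prob_space cong: measurable_cong_sets)
  have \<Phi>K: "\<Phi> \<omega> \<in> borel_measurable (K \<omega>)" if "\<omega> \<in> space M" for \<omega>
    using measurable_compose[OF Pair[OF that] \<Phi>] by simp
  have sp: "s \<in> space S" if "s \<in> space (K \<omega>)" "\<omega> \<in> space M" for s \<omega>
    using that by (simp add: cond_distribution_prob_space)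
  have intK: "integrable (K \<omega>) (\<Phi> \<omega>)" if \<omega>: "\<omega> \<in> space M" for \<omega>
  proof -
    interpret K: prob_space "K \<omega>" by (rule cond_distribution_prob_space[OF \<omega>])
    show ?thesis by (rule K.integrable_const_bound[of _ c]) (use \<Phi>K bound sp \<omega> in auto)
  qed
  have K_const: "(\<integral>s. \<Phi> \<omega> s + c \<partial>K \<omega>) = (\<integral>s. \<Phi> \<omega> s \<partial>K \<omega>) + c" if \<omega>: "\<omega> \<in> space M" for \<omega>
  proof -
    interpret K: prob_space "K \<omega>" by (rule cond_distribution_prob_space[OF \<omega>])
    show ?thesis using intK[OF \<omega>] by (simp add: K.prob_space)
  qed
  show mH[measurable]: "(\<lambda>\<omega>. \<integral>s. \<Phi> \<omega> s \<partial>K \<omega>) \<in> borel_measurable H"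
  proof -
    have "(\<lambda>\<omega>. \<integral>z. (\<lambda>(\<omega>, s). \<Phi> \<omega> s) z \<partial>distr (K \<omega>) (H \<Otimes>\<^sub>M S) (Pair \<omega>)) \<in> borel_measurable H"
      by (rule measurable_compose[OF ker integral_measurable_subprob_algebra[OF \<Phi>]])
    then show ?thesis
      by (rule measurable_cong[THEN iffD1, rotated]) (simp add: spH integral_distr[OF Pair \<Phi>])
  qed
  have mM[measurable]: "(\<lambda>\<omega>. \<integral>s. \<Phi> \<omega> s \<partial>K \<omega>) \<in> borel_measurable M"
    by (rule measurable_from_subalg[OF sub mH])
  have mY[measurable]: "(\<lambda>\<omega>. \<Phi> \<omega> (Y \<omega>)) \<in> borel_measurable M"
    using measurable_compose[OF measurable_Pair[OF id Y] \<Phi>] by simp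
  have Ysp: "Y \<omega> \<in> space S" if "\<omega> \<in> space M" for \<omega> using that Y by (rule measurable_space[rotated])
  have Kb: "\<bar>\<integral>s. \<Phi> \<omega> s \<partial>K \<omega>\<bar> \<le> c" if \<omega>: "\<omega> \<in> space M" for \<omega>
  proof -
    interpret K: prob_space "K \<omega>" by (rule cond_distribution_prob_space[OF \<omega>])
    have "\<bar>\<integral>s. \<Phi> \<omega> s \<partial>K \<omega>\<bar> \<le> (\<integral>s. \<bar>\<Phi> \<omega> s\<bar> \<partial>K \<omega>)" by (rule integral_abs_bound)
    also have "\<dots> \<le> c"
      by (rule K.integral_le_const) (use intK[OF \<omega>] bound sp \<omega> in auto)
    finally show ?thesis .
  qed
  have i1: "integrable M (\<lambda>\<omega>. \<Phi> \<omega> (Y \<omega>))"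
    by (rule integrable_const_bound[of _ c]) (use bound Ysp in auto)
  have i2: "integrable M (\<lambda>\<omega>. \<integral>s. \<Phi> \<omega> s \<partial>K \<omega>)"
    by (rule integrable_const_bound[of _ c]) (use Kb in auto)
  have nn1: "0 \<le> \<Phi> \<omega> s + c" if "\<omega> \<in> space M" "s \<in> space S" for \<omega> s
    using bound[OF that] by linarith
  have nn2: "0 \<le> (\<integral>s. \<Phi> \<omega> s \<partial>K \<omega>) + c" if "\<omega> \<in> space M" for \<omega>
    using Kb[OF that] by linarith
  \<comment> \<open>\<open>nn_integral_bind\<close> handles nonnegative integrands only. Adding the
    bound \<open>c\<close> makes \<open>\<Phi>\<close> nonnegative, and the constant cancels at the
    end since all measures have mass 1.\<close>
  define h where "h z = ennreal ((\<lambda>(\<omega>, s). \<Phi> \<omega> s) z + c)" for z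
  have h[measurable]: "h \<in> borel_measurable (H \<Otimes>\<^sub>M S)" unfolding h_def by measurable
  have "ennreal (\<integral>\<omega>. \<Phi> \<omega> (Y \<omega>) + c \<partial>M) = (\<integral>\<^sup>+\<omega>. h (\<omega>, Y \<omega>) \<partial>M)"
    unfolding h_def using nn1 Ysp i1 by (subst nn_integral_eq_integral) (auto intro!: AE_I2)
  also have "\<dots> = (\<integral>\<^sup>+z. h z \<partial>distr M (H \<Otimes>\<^sub>M S) (\<lambda>\<omega>. (\<omega>, Y \<omega>)))"
    by (subst nn_integral_distr) auto
  also have "\<dots> = (\<integral>\<^sup>+\<omega>. \<integral>\<^sup>+z. h z \<partial>distr (K \<omega>) (H \<Otimes>\<^sub>M S) (Pair \<omega>) \<partial>restr_to_subalg M H)"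
    unfolding cond_distribution_joint
    by (rule nn_integral_bind[OF h]) (use ker sets_restr_to_subalg[OF sub] in \<open>simp cong: measurable_cong_sets\<close>)
  also have "\<dots> = (\<integral>\<^sup>+\<omega>. ennreal ((\<integral>s. \<Phi> \<omega> s \<partial>K \<omega>) + c) \<partial>restr_to_subalg M H)"
  proof (rule nn_integral_cong)
    fix \<omega> assume "\<omega> \<in> space (restr_to_subalg M H)"
    then have \<omega>: "\<omega> \<in> space M" by (simp add: space_restr_to_subalg)
    interpret K: prob_space "K \<omega>" by (rule cond_distribution_prob_space[OF \<omega>])
    have "(\<integral>\<^sup>+z. h z \<partial>distr (K \<omega>) (H \<Otimes>\<^sub>M S) (Pair \<omega>)) = (\<integral>\<^sup>+s. h (\<omega>, s) \<partial>K \<omega>)"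
      by (subst nn_integral_distr[OF Pair[OF \<omega>]]) simp_all
    also have "\<dots> = ennreal (\<integral>s. \<Phi> \<omega> s + c \<partial>K \<omega>)"
      unfolding h_def using nn1 \<omega> sp intK[OF \<omega>] by (subst nn_integral_eq_integral) (auto intro!: AE_I2)
    finally show "(\<integral>\<^sup>+z. h z \<partial>distr (K \<omega>) (H \<Otimes>\<^sub>M S) (Pair \<omega>)) = ennreal ((\<integral>s. \<Phi> \<omega> s \<partial>K \<omega>) + c)"
      by (simp add: K_const[OF \<omega>])
  qed
  also have "\<dots> = (\<integral>\<^sup>+\<omega>. ennreal ((\<integral>s. \<Phi> \<omega> s \<partial>K \<omega>) + c) \<partial>M)"
    by (rule nn_integral_subalgebra2[OF sub]) measurable
  also have "\<dots> = ennreal (\<integral>\<omega>. (\<integral>s. \<Phi> \<omega> s \<partial>K \<omega>) + c \<partial>M)"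
    using nn2 i2 by (intro nn_integral_eq_integral) auto
  finally have "(\<integral>\<omega>. \<Phi> \<omega> (Y \<omega>) + c \<partial>M) = (\<integral>\<omega>. (\<integral>s. \<Phi> \<omega> s \<partial>K \<omega>) + c \<partial>M)"
    using nn1 nn2 Ysp by (subst (asm) ennreal_inj) (auto intro!: integral_nonneg_AE)
  then show "(\<integral>\<omega>. \<Phi> \<omega> (Y \<omega>) \<partial>M) = (\<integral>\<omega>. (\<integral>s. \<Phi> \<omega> s \<partial>K \<omega>) \<partial>M)"
    using i1 i2 by simp
qed

end

section \<open>Concentration\<close>

lemma cosh_le_exp_square:
  fixes x :: real
  shows "cosh x \<le> exp (x\<^sup>2 / 2)"
proof -
  have *: "cosh x \<le> exp (x\<^sup>2 / 2)" if "0 < x" for x :: real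
  proof -
    \<comment> \<open>The auxiliary inequality behind Hoeffding's lemma for weight
      \<open>1/2\<close> and interval length \<open>2 * x\<close>. Its left-hand side is
      \<open>ln (cosh x)\<close>, and \<open>(2 * x)\<^sup>2 / 8\<close> is
      \<open>x\<^sup>2 / 2\<close>.\<close>
    have "- (2 * x) * (1/2) + ln (1 + (1/2) * (exp (2 * x) - 1)) \<le> (2 * x)\<^sup>2 / 8"
      by (rule Hoeffdings_lemma_aux) (use that in auto)
    moreover have "1 + (1/2) * (exp (2 * x) - 1) = exp x * cosh x"
      by (simp add: cosh_def field_simps mult_exp_exp)
    ultimately have "ln (cosh x) \<le> x\<^sup>2 / 2"
      by (simp add: ln_mult power2_eq_square)
    then show ?thesis using exp_le_cancel_iff[of "ln (cosh x)" "x\<^sup>2 / 2"] by (simp del: exp_le_cancel_iff)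
  qed
  show ?thesis
    using *[of x] *[of "- x"] by (cases x "0 :: real" rule: linorder_cases) auto
qed

text \<open>The right-hand side is the chord of the convex function \<open>exp\<close> over the
  interval between \<open>- l * c\<close> and \<open>l * c\<close>. Being affine in
  \<open>y\<close>, it can be averaged knowing only the mean of \<open>y\<close>.\<close>

lemma exp_le_cosh_sinh:
  fixes y c l :: real
  assumes "\<bar>y\<bar> \<le> c" "0 < c"
  shows "exp (l * y) \<le> cosh (l * c) + sinh (l * c) / c * y"
proof -
  define p where "p = (1 + y / c) / 2"
  have p: "0 \<le> p" "p \<le> 1" using assms by (auto simp: p_def field_simps abs_le_iff)
  have "exp ((1 - p) *\<^sub>R (- (l * c)) + p *\<^sub>R (l * c)) \<le> (1 - p) * exp (- (l * c)) + p * exp (l * c)"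
    using convex_onD[OF convex_on_exp[of 1], of p "- (l * c)" "l * c"] p by simp
  moreover have "(1 - p) *\<^sub>R (- (l * c)) + p *\<^sub>R (l * c) = l * y"
    using assms by (simp add: p_def field_simps)
  moreover have "(1 - p) * exp (- (l * c)) + p * exp (l * c) = cosh (l * c) + sinh (l * c) / c * y"
    using assms by (simp add: p_def cosh_def sinh_def field_simps)
  ultimately show ?thesis by simp
qed

text \<open>In place of a filtration, only orthogonality of each increment to exponentials of the
  preceding partial sum is demanded. This is all that the induction on the moment generating
  function consumes: after the chord bound, the linear term contributes nothing positive and each
  increment costs a factor \<open>cosh (l * c)\<close>.\<close>

lemma (in prob_space) azuma:
  fixes D :: "nat \<Rightarrow> 'a \<Rightarrow> real"
  assumes meas [measurable]: "\<And>i. D i \<in> borel_measurable M"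
    and bound: "\<And>i \<omega>. \<omega> \<in> space M \<Longrightarrow> \<bar>D i \<omega>\<bar> \<le> c" and c: "0 < c"
    and orth: "\<And>i l. 0 \<le> l \<Longrightarrow> expectation (\<lambda>\<omega>. exp (l * (\<Sum>k<i. D k \<omega>)) * D i \<omega>) \<le> 0"
    and u: "0 \<le> u" and n: "0 < n"
  shows "prob {\<omega> \<in> space M. u \<le> (\<Sum>k<n. D k \<omega>)} \<le> exp (- u\<^sup>2 / (2 * real n * c\<^sup>2))"
proof -
  have S_bound: "\<bar>\<Sum>k<i. D k \<omega>\<bar> \<le> real i * c" if "\<omega> \<in> space M" for i \<omega>
    using order_trans[OF sum_abs sum_bounded_above[of "{..<i}" "\<lambda>k. \<bar>D k \<omega>\<bar>" c]] bound[OF that]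
    by simp
  have int: "integrable M (\<lambda>\<omega>. exp (l * (\<Sum>k<i. D k \<omega>)))" for i l
  proof (rule integrable_const_bound[of _ "exp (\<bar>l\<bar> * (real i * c))"])
    show "AE \<omega> in M. norm (exp (l * (\<Sum>k<i. D k \<omega>))) \<le> exp (\<bar>l\<bar> * (real i * c))"
    proof (rule AE_I2)
      fix \<omega> assume "\<omega> \<in> space M"
      have "l * (\<Sum>k<i. D k \<omega>) \<le> \<bar>l\<bar> * \<bar>\<Sum>k<i. D k \<omega>\<bar>"
        by (metis abs_ge_self abs_mult)
      also have "\<dots> \<le> \<bar>l\<bar> * (real i * c)" by (intro mult_left_mono S_bound) (use \<open>\<omega> \<in> space M\<close> in auto)
      finally show "norm (exp (l * (\<Sum>k<i. D k \<omega>))) \<le> exp (\<bar>l\<bar> * (real i * c))" by simp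
    qed
  qed measurable
  have intD: "integrable M (\<lambda>\<omega>. exp (l * (\<Sum>k<i. D k \<omega>)) * D i \<omega>)" for i l
  proof (rule Bochner_Integration.integrable_bound)
    show "integrable M (\<lambda>\<omega>. c * exp (l * (\<Sum>k<i. D k \<omega>)))" using int by simp
    show "AE \<omega> in M. norm (exp (l * (\<Sum>k<i. D k \<omega>)) * D i \<omega>) \<le> norm (c * exp (l * (\<Sum>k<i. D k \<omega>)))"
      using bound c by (auto simp: abs_mult mult.commute)
  qed measurable
  have mgf: "expectation (\<lambda>\<omega>. exp (l * (\<Sum>k<i. D k \<omega>))) \<le> exp (real i * (l * c)\<^sup>2 / 2)"
    if l: "0 \<le> l" for l i
  proof (induction i)
    case (Suc i)
    have "expectation (\<lambda>\<omega>. exp (l * (\<Sum>k<Suc i. D k \<omega>)))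
        \<le> expectation (\<lambda>\<omega>. cosh (l * c) * exp (l * (\<Sum>k<i. D k \<omega>))
             + sinh (l * c) / c * (exp (l * (\<Sum>k<i. D k \<omega>)) * D i \<omega>))"
    proof (rule integral_mono)
      show "integrable M (\<lambda>\<omega>. cosh (l * c) * exp (l * (\<Sum>k<i. D k \<omega>))
             + sinh (l * c) / c * (exp (l * (\<Sum>k<i. D k \<omega>)) * D i \<omega>))"
        using int intD by auto
      fix \<omega> assume "\<omega> \<in> space M"
      then have "exp (l * D i \<omega>) \<le> cosh (l * c) + sinh (l * c) / c * D i \<omega>"
        by (intro exp_le_cosh_sinh bound c)
      then have "exp (l * (\<Sum>k<i. D k \<omega>)) * exp (l * D i \<omega>)
          \<le> exp (l * (\<Sum>k<i. D k \<omega>)) * (cosh (l * c) + sinh (l * c) / c * D i \<omega>)"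
        by (rule mult_left_mono) simp
      then show "exp (l * (\<Sum>k<Suc i. D k \<omega>)) \<le> cosh (l * c) * exp (l * (\<Sum>k<i. D k \<omega>))
             + sinh (l * c) / c * (exp (l * (\<Sum>k<i. D k \<omega>)) * D i \<omega>)"
        by (simp add: distrib_left exp_add mult_ac)
    qed (use int[of l "Suc i"] in simp)
    also have "\<dots> = cosh (l * c) * expectation (\<lambda>\<omega>. exp (l * (\<Sum>k<i. D k \<omega>)))
         + sinh (l * c) / c * expectation (\<lambda>\<omega>. exp (l * (\<Sum>k<i. D k \<omega>)) * D i \<omega>)"
      using int[of l i] intD[of l i] by simp
    also have "\<dots> \<le> exp ((l * c)\<^sup>2 / 2) * exp (real i * (l * c)\<^sup>2 / 2) + 0"
    proof (rule add_mono)
      show "cosh (l * c) * expectation (\<lambda>\<omega>. exp (l * (\<Sum>k<i. D k \<omega>)))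
          \<le> exp ((l * c)\<^sup>2 / 2) * exp (real i * (l * c)\<^sup>2 / 2)"
        by (rule mult_mono[OF cosh_le_exp_square Suc.IH]) (auto intro: integral_nonneg_AE)
      show "sinh (l * c) / c * expectation (\<lambda>\<omega>. exp (l * (\<Sum>k<i. D k \<omega>)) * D i \<omega>) \<le> 0"
        using orth[OF l, of i] l c by (intro mult_nonneg_nonpos) auto
    qed
    also have "\<dots> = exp (real (Suc i) * (l * c)\<^sup>2 / 2)"
      by (simp add: exp_add[symmetric] field_simps)
    finally show ?case .
  qed (simp add: prob_space)
  \<comment> \<open>The minimiser of the exponent
    \<open>real n * (l * c)\<^sup>2 / 2 - l * u\<close> that Markov's inequality leaves.\<close>
  define l where "l = u / (real n * c\<^sup>2)"
  have l: "0 \<le> l" using u c by (simp add: l_def)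
  have "prob {\<omega> \<in> space M. u \<le> (\<Sum>k<n. D k \<omega>)}
      \<le> prob {\<omega> \<in> space M. exp (l * u) \<le> exp (l * (\<Sum>k<n. D k \<omega>))}"
    by (rule finite_measure_mono) (auto intro: mult_left_mono l)
  also have "\<dots> \<le> expectation (\<lambda>\<omega>. exp (l * (\<Sum>k<n. D k \<omega>))) / exp (l * u)"
    by (rule integral_Markov_inequality_measure[where A = "{}"]) (use int in auto)
  also have "\<dots> \<le> exp (real n * (l * c)\<^sup>2 / 2) / exp (l * u)"
    by (rule divide_right_mono[OF mgf[OF l]]) simp
  also have "\<dots> = exp (real n * (l * c)\<^sup>2 / 2 - l * u)" by (simp add: exp_diff)
  also have "real n * (l * c)\<^sup>2 / 2 - l * u = - u\<^sup>2 / (2 * real n * c\<^sup>2)"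
    using n c by (simp add: l_def field_simps power2_eq_square)
  finally show ?thesis .
qed

text \<open>The intersection over a possibly uncountable \<open>I\<close> is the single event that
  \<open>W\<close> is at most the infimum \<open>L\<close> of the thresholds, which also makes it
  measurable. As \<open>L\<close> need not be attained, its complement is exhausted by the events
  \<open>A m\<close>: each level \<open>L + 1 / real (Suc m)\<close> lies above some
  \<open>r e\<close>, and continuity from below passes to the limit.\<close>

lemma (in prob_space) prob_all_le:
  fixes r :: "'i \<Rightarrow> real"
  assumes W[measurable]: "W \<in> borel_measurable M" and nonneg: "\<And>e. e \<in> I \<Longrightarrow> 0 \<le> r e"
    and le: "\<And>e. e \<in> I \<Longrightarrow> prob {\<omega> \<in> space M. r e < W \<omega>} \<le> \<delta>" and \<delta>: "0 \<le> \<delta>"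
  shows "1 - \<delta> \<le> prob {\<omega> \<in> space M. \<forall>e\<in>I. W \<omega> \<le> r e}"
proof (cases "I = {}")
  case True
  then show ?thesis using \<delta> by (simp add: prob_space)
next
  case False
  define L where "L = (INF e\<in>I. r e)"
  have bdd: "bdd_below (r ` I)" using nonneg by (auto intro!: bdd_belowI2)
  define A where "A m = {\<omega> \<in> space M. L + 1 / real (Suc m) < W \<omega>}" for m
  have A_le: "prob (A m) \<le> \<delta>" for m
  proof -
    have "L < L + 1 / real (Suc m)" by simp
    then obtain e where e: "e \<in> I" "r e < L + 1 / real (Suc m)"
      unfolding L_def using cINF_less_iff[OF False bdd] by blast
    have "prob (A m) \<le> prob {\<omega> \<in> space M. r e < W \<omega>}"
      by (rule finite_measure_mono) (use e in \<open>auto simp: A_def\<close>)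
    then show ?thesis using le[OF e(1)] by simp
  qed
  have "(\<lambda>m. prob (A m)) \<longlonglongrightarrow> prob (\<Union>m. A m)"
  proof (rule finite_Lim_measure_incseq)
    have "1 / real (Suc m') \<le> 1 / real (Suc m)" if "m \<le> m'" for m m'
      using that by (simp add: frac_le)
    then show "incseq A" unfolding A_def incseq_def by fastforce
  qed (auto simp: A_def)
  then have "prob (\<Union>m. A m) \<le> \<delta>" by (rule LIMSEQ_le_const2) (use A_le in auto)
  also have "(\<Union>m. A m) = space M - {\<omega> \<in> space M. W \<omega> \<le> L}"
  proof (intro set_eqI iffI)
    fix \<omega> assume "\<omega> \<in> (\<Union>m. A m)"
    then obtain m where "\<omega> \<in> space M" "L + 1 / real (Suc m) < W \<omega>" by (auto simp: A_def)
    moreover have "0 < 1 / real (Suc m)" by simp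
    ultimately have "\<omega> \<in> space M" "\<not> W \<omega> \<le> L" by linarith+
    then show "\<omega> \<in> space M - {\<omega> \<in> space M. W \<omega> \<le> L}" by simp
  next
    fix \<omega> assume "\<omega> \<in> space M - {\<omega> \<in> space M. W \<omega> \<le> L}"
    then show "\<omega> \<in> (\<Union>m. A m)"
      using reals_Archimedean[of "W \<omega> - L"] by (auto simp: A_def inverse_eq_divide algebra_simps)
  qed
  also have "prob (space M - {\<omega> \<in> space M. W \<omega> \<le> L}) = 1 - prob {\<omega> \<in> space M. W \<omega> \<le> L}"
    by (rule prob_compl) measurable
  also have "{\<omega> \<in> space M. W \<omega> \<le> L} = {\<omega> \<in> space M. \<forall>e\<in>I. W \<omega> \<le> r e}"
    unfolding L_def using le_cINF_iff[OF False bdd] by auto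
  finally show ?thesis by simp
qed

section \<open>Mirror descent steps\<close>

text \<open>Differentiability holds only within \<open>X\<close>, so the derivative is one-sided
  along the segment from \<open>u\<close> to \<open>z\<close>. The sequential form serves two
  purposes: first-order optimality, and measurability of the limit in \<open>u\<close>.\<close>

lemma gradient_on_direction:
  fixes X :: "'a::euclidean_space set"
  assumes X: "convex X" and grad: "gradient_on X \<psi> grad" and u: "u \<in> X" and z: "z \<in> X"
  shows "(\<lambda>n. real (Suc n) * (\<psi> (u + (1 / real (Suc n)) *\<^sub>R (z - u)) - \<psi> u))
           \<longlonglongrightarrow> grad u \<bullet> (z - u)"
proof -
  define p where "p h = u + h *\<^sub>R (z - u)" for h :: real
  have pX: "p h \<in> X" if "0 \<le> h" "h \<le> 1" for h
    using convexD_alt[OF X u z, of h] that by (simp add: p_def algebra_simps)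
  have "(p has_derivative (\<lambda>h. h *\<^sub>R (z - u))) (at 0 within {0..1})"
    unfolding p_def by (auto intro!: derivative_eq_intros)
  moreover have "(\<psi> has_derivative (\<lambda>v. grad u \<bullet> v)) (at (p 0) within p ` {0..1})"
    by (rule has_derivative_subset[of _ _ _ X]) (use grad u pX in \<open>auto simp: gradient_on_def p_def\<close>)
  ultimately have "((\<lambda>h. \<psi> (p h)) has_derivative (\<lambda>h. grad u \<bullet> (h *\<^sub>R (z - u)))) (at 0 within {0..1})"
    by (rule has_derivative_in_compose)
  then have "((\<lambda>h. \<psi> (p h)) has_field_derivative (grad u \<bullet> (z - u))) (at 0 within {0..1})"
    by (simp add: has_field_derivative_def mult_commute_abs)
  then have lim: "((\<lambda>h. (\<psi> (p h) - \<psi> (p 0)) / h) \<longlongrightarrow> grad u \<bullet> (z - u)) (at 0 within {0..1})"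
    by (simp add: has_field_derivative_iff)
  have "filterlim (\<lambda>n. 1 / real (Suc n)) (at 0 within {0..1}) sequentially"
    unfolding filterlim_at using LIMSEQ_Suc[OF lim_1_over_n] by (auto simp: field_simps)
  from filterlim_compose[OF lim this] show ?thesis
    by (simp add: p_def mult.commute)
qed

text \<open>The minimiser is compared with the points \<open>u + h *\<^sub>R (z - u)\<close>, which
  convexity keeps in \<open>X\<close>; dividing by \<open>h\<close> and letting it tend to 0 gives
  the variational inequality.\<close>

lemma bregman_arg_min_optimality:
  fixes X :: "'a::euclidean_space set"
  assumes X: "convex X" and grad: "gradient_on X \<psi> grad" and a: "0 < a"
    and u: "is_arg_min (\<lambda>z. v \<bullet> z + bregman \<psi> grad z y / a) (\<lambda>z. z \<in> X) u" and z: "z \<in> X"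
  shows "0 \<le> a * (v \<bullet> (z - u)) + (grad u - grad y) \<bullet> (z - u)"
proof -
  have uX: "u \<in> X" using u by (simp add: is_arg_min_def)
  define q where "q n = real (Suc n) * (\<psi> (u + (1 / real (Suc n)) *\<^sub>R (z - u)) - \<psi> u)" for n
  have "q \<longlonglongrightarrow> grad u \<bullet> (z - u)"
    unfolding q_def by (rule gradient_on_direction[OF X grad uX z])
  then have "(\<lambda>n. q n + a * (v \<bullet> (z - u)) - grad y \<bullet> (z - u))
      \<longlonglongrightarrow> grad u \<bullet> (z - u) + a * (v \<bullet> (z - u)) - grad y \<bullet> (z - u)"
    by (intro tendsto_intros)
  moreover have "0 \<le> q n + a * (v \<bullet> (z - u)) - grad y \<bullet> (z - u)" for n
  proof -
    define h where "h = 1 / real (Suc n)"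
    define p where "p = u + h *\<^sub>R (z - u)"
    have h: "0 < h" "h \<le> 1" by (auto simp: h_def)
    have "p \<in> X" using convexD_alt[OF X uX z, of h] h by (simp add: p_def algebra_simps)
    then have "v \<bullet> u + bregman \<psi> grad u y / a \<le> v \<bullet> p + bregman \<psi> grad p y / a"
      using u by (auto simp: is_arg_min_linorder)
    then have "a * (v \<bullet> u + bregman \<psi> grad u y / a) \<le> a * (v \<bullet> p + bregman \<psi> grad p y / a)"
      using a by (intro mult_left_mono) auto
    then have "0 \<le> a * (v \<bullet> (p - u)) + (bregman \<psi> grad p y - bregman \<psi> grad u y)"
      using a by (simp add: distrib_left inner_diff_right right_diff_distrib)
    also have "\<dots> = h * (a * (v \<bullet> (z - u))) + (\<psi> p - \<psi> u) - h * (grad y \<bullet> (z - u))"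
      by (simp add: bregman_def p_def inner_diff_right inner_add_right algebra_simps)
    also have "\<psi> p - \<psi> u = h * q n" by (simp add: q_def h_def p_def)
    finally have "0 \<le> h * (q n + a * (v \<bullet> (z - u)) - grad y \<bullet> (z - u))"
      by (simp add: algebra_simps)
    then show ?thesis using h by (simp add: zero_le_mult_iff)
  qed
  ultimately have "0 \<le> grad u \<bullet> (z - u) + a * (v \<bullet> (z - u)) - grad y \<bullet> (z - u)"
    by (intro LIMSEQ_le_const) auto
  then show ?thesis by (simp add: inner_diff_left)
qed

lemma is_norm_minus: "is_norm n \<Longrightarrow> n (x - y) = n (y - x)"
  using is_norm_def[of n] by (metis abs_minus_cancel abs_one minus_diff_eq mult_1 scaleR_minus1_left)

lemma is_norm_nonneg: "is_norm n \<Longrightarrow> 0 \<le> n x"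
  by (simp add: is_norm_def)

lemma bregman_ge:
  assumes n: "is_norm n" and sc: "strongly_convex_1 n X \<psi> grad" and "x \<in> X" "y \<in> X"
  shows "(n (x - y))\<^sup>2 / 2 \<le> bregman \<psi> grad x y"
  using sc assms(3,4) is_norm_minus[OF n, of x y] by (force simp: strongly_convex_1_def bregman_def)

context
  fixes X :: "'a::euclidean_space set" and n :: "'a \<Rightarrow> real" and \<psi> grad v y u and a :: real
  assumes X: "convex X" and grad: "gradient_on X \<psi> grad" and a: "0 < a"
    and n: "is_norm n" and sc: "strongly_convex_1 n X \<psi> grad" and y: "y \<in> X"
    and u: "is_arg_min (\<lambda>z. v \<bullet> z + bregman \<psi> grad z y / a) (\<lambda>z. z \<in> X) u"
begin

lemma mirror_step_in: "u \<in> X"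
  using u by (simp add: is_arg_min_def)

text \<open>With \<open>D\<close> for \<open>bregman \<psi> grad\<close>, the three-point identity
  is \<open>D z y - D u y = D z u + (grad u - grad y) \<bullet> (z - u)\<close>. Optimality
  therefore leaves the surplus \<open>D z u\<close>, which strong convexity bounds below. This
  growth later makes the minimiser a measurable function of its data.\<close>

lemma mirror_step_growth:
  assumes z: "z \<in> X"
  shows "v \<bullet> u + bregman \<psi> grad u y / a + (n (z - u))\<^sup>2 / (2 * a) \<le> v \<bullet> z + bregman \<psi> grad z y / a"
proof -
  have "0 \<le> a * (v \<bullet> (z - u)) + (grad u - grad y) \<bullet> (z - u)"
    by (rule bregman_arg_min_optimality[OF X grad a u z])
  moreover have "(n (z - u))\<^sup>2 / 2 \<le> bregman \<psi> grad z u"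
    by (rule bregman_ge[OF n sc z mirror_step_in])
  ultimately have "0 \<le> a * (v \<bullet> (z - u)) + (bregman \<psi> grad z y - bregman \<psi> grad u y) - (n (z - u))\<^sup>2 / 2"
    by (simp add: bregman_def inner_diff_left inner_diff_right)
  then have "0 \<le> (a * (v \<bullet> (z - u)) + (bregman \<psi> grad z y - bregman \<psi> grad u y) - (n (z - u))\<^sup>2 / 2) / a"
    using a by simp
  also have "\<dots> = v \<bullet> (z - u) + (bregman \<psi> grad z y / a - bregman \<psi> grad u y / a) - (n (z - u))\<^sup>2 / (2 * a)"
    using a by (simp add: field_simps)
  finally show ?thesis by (simp add: inner_diff_right)
qed

text \<open>Optimality is tested at \<open>z = y\<close>. The two Bregman divergences between
  \<open>u\<close> and \<open>y\<close> add up to \<open>(grad u - grad y) \<bullet> (u - y)\<close>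
  and each is at least half the squared distance, so \<open>(n (y - u))\<^sup>2\<close> is at most
  \<open>a * (v \<bullet> (y - u))\<close>; one factor \<open>n (y - u)\<close> then
  cancels.\<close>

lemma mirror_step_move:
  assumes D: "dual_norm n v \<le> D"
  shows "n (y - u) \<le> a * D"
\<comment> \<open>Cancelling needs a nonzero distance. In the degenerate case \<open>D\<close> must
  be shown nonnegative, which follows by testing the dual norm on a basis vector and on its
  negative.\<close>
proof (cases "n (y - u) = 0")
  case True
  have "0 \<le> dual_norm n v"
  proof -
    obtain b :: 'a where b: "b \<in> Basis" using nonempty_Basis by blast
    have pos: "0 < n b" "n (- b) = n b"
      using n b nonzero_Basis[OF b] is_norm_minus[OF n, of 0 b] by (auto simp: is_norm_def less_le)
    have "0 \<le> dual_norm n v * n b"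
      using inner_le_dual_norm[OF n, of v b] inner_le_dual_norm[OF n, of v "- b"] pos by simp
    then show ?thesis using pos by (simp add: zero_le_mult_iff)
  qed
  then show ?thesis using True D a by simp
next
  case False
  then have pos: "0 < n (y - u)" using is_norm_nonneg[OF n, of "y - u"] by simp
  have "0 \<le> a * (v \<bullet> (y - u)) + (grad u - grad y) \<bullet> (y - u)"
    by (rule bregman_arg_min_optimality[OF X grad a u y])
  moreover have "(n (y - u))\<^sup>2 / 2 \<le> bregman \<psi> grad y u"
    by (rule bregman_ge[OF n sc y mirror_step_in])
  moreover have "(n (y - u))\<^sup>2 / 2 \<le> bregman \<psi> grad u y"
    using bregman_ge[OF n sc mirror_step_in y] is_norm_minus[OF n, of u y] by simp
  ultimately have "(n (y - u))\<^sup>2 \<le> a * (v \<bullet> (y - u))"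
    by (simp add: bregman_def inner_diff_left inner_diff_right)
  also have "\<dots> \<le> a * (D * n (y - u))"
    using inner_le_dual_norm[OF n, of v "y - u"] mult_right_mono[OF D is_norm_nonneg[OF n, of "y - u"]] a
    by (intro mult_left_mono) auto
  finally show ?thesis using pos by (simp add: power2_eq_square)
qed

text \<open>The three-point identity handles \<open>u - z\<close> and leaves
  \<open>a * (v \<bullet> (y - u))\<close>. Young's inequality splits this into
  \<open>(a * D)\<^sup>2 / 2\<close> and half the squared distance, and the latter is absorbed by
  \<open>bregman \<psi> grad u y\<close>.\<close>

lemma mirror_step_regret:
  assumes D: "dual_norm n v \<le> D" and z: "z \<in> X"
  shows "v \<bullet> (y - z) \<le> (bregman \<psi> grad z y - bregman \<psi> grad z u) / a + a * D\<^sup>2 / 2"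
proof -
  have 1: "0 \<le> a * (v \<bullet> (z - u)) + (grad u - grad y) \<bullet> (z - u)"
    by (rule bregman_arg_min_optimality[OF X grad a u z])
  have 2: "(n (y - u))\<^sup>2 / 2 \<le> bregman \<psi> grad u y"
    using bregman_ge[OF n sc mirror_step_in y] is_norm_minus[OF n, of u y] by simp
  have "v \<bullet> (y - u) \<le> D * n (y - u)"
    using inner_le_dual_norm[OF n, of v "y - u"] mult_right_mono[OF D is_norm_nonneg[OF n, of "y - u"]]
    by linarith
  then have "a * (v \<bullet> (y - u)) \<le> a * (D * n (y - u))" using a by (intro mult_left_mono) auto
  also have "\<dots> \<le> (a * D)\<^sup>2 / 2 + (n (y - u))\<^sup>2 / 2"
    using sum_squares_bound[of "a * D" "n (y - u)"] by simp
  finally have "a * (v \<bullet> (y - z)) \<le> bregman \<psi> grad z y - bregman \<psi> grad z u + (a * D)\<^sup>2 / 2"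
    using 1 2 by (simp add: bregman_def inner_diff_left inner_diff_right algebra_simps)
  also have "\<dots> = a * ((bregman \<psi> grad z y - bregman \<psi> grad z u) / a + a * D\<^sup>2 / 2)"
    using a by (simp add: field_simps power2_eq_square)
  finally show ?thesis using a by simp
qed

end

text \<open>Summation by parts with nondecreasing weights \<open>1 / \<alpha> t\<close>. The
  induction carries the stronger bound with \<open>B - b (Suc T)\<close>: this is nonnegative, so
  passing to the next weight only weakens the bound, after which the \<open>b\<close> terms cancel.
  The start \<open>s\<close> is free because the application begins at the lag.\<close>

lemma telescoping_regret:
  fixes \<alpha> b r :: "nat \<Rightarrow> real"
  assumes step: "\<And>t. s \<le> t \<Longrightarrow> r t \<le> (b t - b (Suc t)) / \<alpha> t + \<alpha> t * C"
    and b: "\<And>t. s \<le> t \<Longrightarrow> 0 \<le> b t" "\<And>t. s \<le> t \<Longrightarrow> b t \<le> B"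
    and \<alpha>: "\<And>t. s \<le> t \<Longrightarrow> 0 < \<alpha> t" "\<And>t. s \<le> t \<Longrightarrow> \<alpha> (Suc t) \<le> \<alpha> t"
    and T: "s \<le> T"
  shows "(\<Sum>t=s..T. r t) \<le> B / \<alpha> T + C * (\<Sum>t=s..T. \<alpha> t)"
proof -
  have "(\<Sum>t=s..T. r t) \<le> (B - b (Suc T)) / \<alpha> T + C * (\<Sum>t=s..T. \<alpha> t)"
    using T
  proof (induction T rule: dec_induct)
    case base
    have "(b s - b (Suc s)) / \<alpha> s \<le> (B - b (Suc s)) / \<alpha> s"
      using b(2)[of s] \<alpha>(1)[of s] by (intro divide_right_mono) auto
    then show ?case using step[of s] by (simp add: mult.commute)
  next
    case (step T)
    have "(B - b (Suc T)) / \<alpha> T \<le> (B - b (Suc T)) / \<alpha> (Suc T)"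
      using b(2)[of "Suc T"] \<alpha>(1)[of T] \<alpha>(1)[of "Suc T"] \<alpha>(2)[of T] step.hyps
      by (intro divide_left_mono) auto
    moreover have "r (Suc T) \<le> (b (Suc T) - b (Suc (Suc T))) / \<alpha> (Suc T) + \<alpha> (Suc T) * C"
      using assms(1)[of "Suc T"] step.hyps by simp
    moreover have "(B - b (Suc T)) / \<alpha> (Suc T) + (b (Suc T) - b (Suc (Suc T))) / \<alpha> (Suc T)
        = (B - b (Suc (Suc T))) / \<alpha> (Suc T)"
      by (simp add: add_divide_distrib[symmetric])
    ultimately show ?case using step by (simp add: algebra_simps)
  qed
  also have "(B - b (Suc T)) / \<alpha> T \<le> B / \<alpha> T"
    using b(1)[of "Suc T"] \<alpha>(1)[of T] T by (intro divide_right_mono) auto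
  finally show ?thesis by simp
qed

section \<open>Measurability of subgradient sums and minimisers\<close>

text \<open>Left-endpoint sums lie below the increment and right-endpoint sums above it. The two
  differ only by the end terms divided by the number of pieces, so any selection of subgradients
  works, with no regularity along the segment.\<close>

lemma subgradient_riemann_sum:
  fixes h :: "'a::euclidean_space \<Rightarrow> real"
  assumes X: "convex X" and x: "x \<in> X" and z: "z \<in> X"
    and sub: "\<And>p q. p \<in> X \<Longrightarrow> q \<in> X \<Longrightarrow> h p + g p \<bullet> (q - p) \<le> h q"
  shows "(\<lambda>n. (\<Sum>i<Suc n. g (x + (real i / real (Suc n)) *\<^sub>R (z - x)) \<bullet> (z - x)) / real (Suc n))
           \<longlonglongrightarrow> h z - h x"
proof -
  define p where "p n i = x + (real i / real (Suc n)) *\<^sub>R (z - x)" for n i :: nat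
  define L where "L n = (\<Sum>i<Suc n. g (p n i) \<bullet> (z - x)) / real (Suc n)" for n
  have pX: "p n i \<in> X" if "i \<le> Suc n" for n i
    using convexD_alt[OF X x z, of "real i / real (Suc n)"] that
    by (simp add: p_def algebra_simps divide_le_eq_1)
  have diff: "p n (Suc i) - p n i = (1 / real (Suc n)) *\<^sub>R (z - x)" for n i
    by (simp add: p_def scaleR_diff_left[symmetric] diff_divide_distrib[symmetric])
  have p0: "p n 0 = x" "p n (Suc n) = z" for n by (simp_all add: p_def)
  have tele: "(\<Sum>i<Suc n. h (p n (Suc i)) - h (p n i)) = h z - h x" for n
    by (subst sum_lessThan_telescope) (simp add: p0)
  have lower: "L n \<le> h z - h x" for n
  proof -
    have "L n = (\<Sum>i<Suc n. g (p n i) \<bullet> (p n (Suc i) - p n i))"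
      unfolding L_def diff by (simp add: sum_divide_distrib del: sum.lessThan_Suc)
    also have "\<dots> \<le> (\<Sum>i<Suc n. h (p n (Suc i)) - h (p n i))"
    proof (rule sum_mono)
      fix i assume "i \<in> {..<Suc n}"
      then show "g (p n i) \<bullet> (p n (Suc i) - p n i) \<le> h (p n (Suc i)) - h (p n i)"
        using sub[of "p n i" "p n (Suc i)"] pX by simp
    qed
    finally show ?thesis by (simp only: tele)
  qed
  have upper: "h z - h x \<le> L n + (g z - g x) \<bullet> (z - x) / real (Suc n)" for n
  proof -
    have "h z - h x = (\<Sum>i<Suc n. h (p n (Suc i)) - h (p n i))" by (simp only: tele)
    also have "\<dots> \<le> (\<Sum>i<Suc n. g (p n (Suc i)) \<bullet> (p n (Suc i) - p n i))"
    proof (rule sum_mono)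
      fix i assume "i \<in> {..<Suc n}"
      then show "h (p n (Suc i)) - h (p n i) \<le> g (p n (Suc i)) \<bullet> (p n (Suc i) - p n i)"
        using sub[of "p n (Suc i)" "p n i"] pX by (simp add: inner_diff_right)
    qed
    also have "\<dots> = (\<Sum>i<Suc n. g (p n (Suc i)) \<bullet> (z - x)) / real (Suc n)"
      unfolding diff by (simp add: sum_divide_distrib del: sum.lessThan_Suc)
    also have "(\<Sum>i<Suc n. g (p n (Suc i)) \<bullet> (z - x))
        = (\<Sum>i<Suc n. g (p n i) \<bullet> (z - x)) + (g z - g x) \<bullet> (z - x)"
      using sum_lessThan_telescope[of "\<lambda>i. g (p n i) \<bullet> (z - x)" "Suc n"]
      by (simp only: sum_subtractf p0 inner_diff_left)
    finally show ?thesis by (simp add: L_def add_divide_distrib)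
  qed
  have "(\<lambda>n. (g z - g x) \<bullet> (z - x) / real (Suc n)) \<longlonglongrightarrow> 0"
    using LIMSEQ_Suc[OF lim_const_over_n] .
  then have lim: "(\<lambda>n. h z - h x - (g z - g x) \<bullet> (z - x) / real (Suc n)) \<longlonglongrightarrow> h z - h x"
    using tendsto_diff[OF tendsto_const] by fastforce
  have "L \<longlonglongrightarrow> h z - h x"
  proof (rule tendsto_sandwich[OF _ _ lim tendsto_const])
    show "\<forall>\<^sub>F n in sequentially. h z - h x - (g z - g x) \<bullet> (z - x) / real (Suc n) \<le> L n"
      using upper by (auto intro!: always_eventually simp: diff_le_eq)
    show "\<forall>\<^sub>F n in sequentially. L n \<le> h z - h x" using lower by simp
  qed
  then show ?thesis unfolding L_def[abs_def] p_def .
qed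

text \<open>A near-minimiser can be chosen measurably as the first sufficiently good point of a
  countable dense sequence. The growth condition turns a nearly optimal value into a small distance
  to \<open>u \<omega>\<close>, so \<open>u\<close> is a pointwise limit of measurable maps.\<close>

lemma measurable_arg_min_growth:
  fixes X :: "'a::euclidean_space set" and \<Phi> :: "'w \<Rightarrow> 'a \<Rightarrow> real"
  assumes meas: "\<And>z. z \<in> X \<Longrightarrow> (\<lambda>\<omega>. \<Phi> \<omega> z) \<in> borel_measurable H"
    and cont: "\<And>\<omega>. \<omega> \<in> space H \<Longrightarrow> continuous_on X (\<Phi> \<omega>)"
    and u: "\<And>\<omega>. \<omega> \<in> space H \<Longrightarrow> u \<omega> \<in> X" and c: "0 < c"
    and growth: "\<And>\<omega> z. \<omega> \<in> space H \<Longrightarrow> z \<in> X \<Longrightarrow> \<Phi> \<omega> (u \<omega>) + c * (norm (z - u \<omega>))\<^sup>2 \<le> \<Phi> \<omega> z"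
  shows "u \<in> borel_measurable H"
proof (cases "X = {}")
  case True
  then have "space H = {}" using u by auto
  then show ?thesis by (auto simp: measurable_def)
next
  case False
  obtain D where D: "countable D" "D \<subseteq> X" "X \<subseteq> closure D" by (rule separable)
  then have "D \<noteq> {}" using False by auto
  define d where "d = from_nat_into D"
  have d: "range d = D" unfolding d_def by (rule range_from_nat_into) fact+
  then have dX: "d i \<in> X" for i using D by auto
  have dense: "\<exists>i. \<Phi> \<omega> (d i) < \<Phi> \<omega> z + e" if \<omega>: "\<omega> \<in> space H" and z: "z \<in> X" and e: "0 < e" for \<omega> z e
  proof -
    obtain r where r: "0 < r" "\<And>y. y \<in> X \<Longrightarrow> dist y z < r \<Longrightarrow> dist (\<Phi> \<omega> y) (\<Phi> \<omega> z) < e"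
      using cont[OF \<omega>] z e unfolding continuous_on_iff by meson
    obtain y where "y \<in> D" "dist y z < r"
      using D(3) z r(1) by (metis closure_approachable subsetD)
    then obtain i where "y = d i" "dist (d i) z < r" using d by auto
    then show ?thesis using r(2)[of "d i"] dX by (auto simp: dist_real_def intro!: exI[of _ i])
  qed
  \<comment> \<open>The optimal value is not yet known to be measurable, so it is replaced by the
    values at all \<open>d k\<close>: countably many measurable conditions, and by continuity just
    as strong.\<close>
  define P where "P n \<omega> i \<longleftrightarrow> (\<forall>k. \<Phi> \<omega> (d i) \<le> \<Phi> \<omega> (d k) + 1 / real (Suc n))" for n \<omega> i
  define j where "j n \<omega> = (LEAST i. P n \<omega> i)" for n \<omega>
  have P: "P n \<omega> (j n \<omega>)" if \<omega>: "\<omega> \<in> space H" for n \<omega>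
  proof -
    obtain i where i: "\<Phi> \<omega> (d i) < \<Phi> \<omega> (u \<omega>) + 1 / real (Suc n)"
      using dense[OF \<omega> u[OF \<omega>], of "1 / real (Suc n)"] by auto
    have "\<Phi> \<omega> (u \<omega>) \<le> \<Phi> \<omega> (d k)" for k
    proof -
      have "0 \<le> c * (norm (d k - u \<omega>))\<^sup>2" using c by simp
      then show ?thesis using growth[OF \<omega> dX[of k]] by linarith
    qed
    then have "P n \<omega> i" unfolding P_def using i by (smt (verit))
    then show ?thesis unfolding j_def by (rule LeastI)
  qed
  have [measurable]: "(\<lambda>\<omega>. \<Phi> \<omega> (d i)) \<in> borel_measurable H" for i by (rule meas[OF dX])
  have [measurable]: "j n \<in> H \<rightarrow>\<^sub>M count_space UNIV" for n
    unfolding j_def P_def by measurable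
  show ?thesis
  proof (rule borel_measurable_LIMSEQ_metric)
    show "(\<lambda>\<omega>. d (j n \<omega>)) \<in> borel_measurable H" for n by measurable
    fix \<omega> assume \<omega>: "\<omega> \<in> space H"
    have le: "c * (norm (d (j n \<omega>) - u \<omega>))\<^sup>2 \<le> 1 / real (Suc n)" for n
    proof -
      have "\<Phi> \<omega> (d (j n \<omega>)) \<le> \<Phi> \<omega> (u \<omega>) + 1 / real (Suc n)"
      proof (rule field_le_epsilon)
        fix e :: real assume "0 < e"
        then obtain k where "\<Phi> \<omega> (d k) < \<Phi> \<omega> (u \<omega>) + e" using dense[OF \<omega> u[OF \<omega>]] by auto
        moreover have "\<Phi> \<omega> (d (j n \<omega>)) \<le> \<Phi> \<omega> (d k) + 1 / real (Suc n)"
          using P[OF \<omega>, of n] by (simp add: P_def)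
        ultimately show "\<Phi> \<omega> (d (j n \<omega>)) \<le> \<Phi> \<omega> (u \<omega>) + 1 / real (Suc n) + e" by linarith
      qed
      then show ?thesis using growth[OF \<omega> dX[of "j n \<omega>"]] by linarith
    qed
    have "(\<lambda>n. c * (norm (d (j n \<omega>) - u \<omega>))\<^sup>2) \<longlonglongrightarrow> 0"
      by (rule tendsto_sandwich[OF _ _ tendsto_const LIMSEQ_Suc[OF lim_1_over_n]])
        (use le c in auto)
    from tendsto_mult_left[OF this, of "1 / c"]
    have "(\<lambda>n. (norm (d (j n \<omega>) - u \<omega>))\<^sup>2) \<longlonglongrightarrow> 0" using c by simp
    from tendsto_real_sqrt[OF this] have "(\<lambda>n. norm (d (j n \<omega>) - u \<omega>)) \<longlonglongrightarrow> 0" by simp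
    then show "(\<lambda>n. d (j n \<omega>)) \<longlonglongrightarrow> u \<omega>"
      by (simp add: LIM_zero_iff tendsto_norm_zero_iff)
  qed
qed

section \<open>The iterates as a stochastic process\<close>

text \<open>\<open>F\<close> is real-valued here: all points that occur lie in \<open>X\<close>,
  where the extended-real losses are finite, and the subgradient inequality is tested only between
  points of \<open>X\<close>.\<close>

locale ergodic_mirror_descent =
  fixes \<pi> :: "'x measure" and M :: "'w measure" and X :: "'a::euclidean_space set"
    and n :: "'a \<Rightarrow> real" and F :: "'a \<Rightarrow> 'x \<Rightarrow> real" and g :: "'a \<Rightarrow> 'x \<Rightarrow> 'a"
    and \<psi> :: "'a \<Rightarrow> real" and grad :: "'a \<Rightarrow> 'a" and R G :: real
    and \<xi> :: "nat \<Rightarrow> 'w \<Rightarrow> 'x" and K :: "nat \<Rightarrow> nat \<Rightarrow> 'w \<Rightarrow> 'x measure"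
    and \<alpha> :: "nat \<Rightarrow> real" and x :: "nat \<Rightarrow> 'w \<Rightarrow> 'a" and x1 xstar :: 'a
  assumes prob_pi: "prob_space \<pi>" and prob_M: "prob_space M"
    and convex_X: "convex X" and norm_n: "is_norm n"
    and F_integrable: "\<And>z. z \<in> X \<Longrightarrow> integrable \<pi> (F z)"
    and subgradient: "\<And>y z s. y \<in> X \<Longrightarrow> z \<in> X \<Longrightarrow> s \<in> space \<pi> \<Longrightarrow> F z s + g z s \<bullet> (y - z) \<le> F y s"
    and g_measurable: "(\<lambda>(z, s). g z s) \<in> restrict_space borel X \<Otimes>\<^sub>M \<pi> \<rightarrow>\<^sub>M borel"
    and gradient: "gradient_on X \<psi> grad" and strong: "strongly_convex_1 n X \<psi> grad"
    and R_nonneg: "0 \<le> R"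
    and bregman_le: "\<And>y z. y \<in> X \<Longrightarrow> z \<in> X \<Longrightarrow> bregman \<psi> grad y z \<le> R\<^sup>2 / 2"
    and xi_measurable: "\<And>t. 1 \<le> t \<Longrightarrow> \<xi> t \<in> M \<rightarrow>\<^sub>M \<pi>"
    and kernel: "\<And>s t. s < t \<Longrightarrow> cond_distribution M (past M \<pi> \<xi> s) \<pi> (\<xi> t) (K s t)"
    and F_lipschitz: "AE s in \<pi>. \<forall>y\<in>X. \<forall>z\<in>X. \<bar>F y s - F z s\<bar> \<le> G * n (y - z)"
    and G_nonneg: "0 \<le> G"
    and g_bounded: "subgradients_bounded M \<xi> n G X g"
    and alpha_pos: "\<And>t. 1 \<le> t \<Longrightarrow> 0 < \<alpha> t"
    and alpha_mono: "\<And>s t. 1 \<le> s \<Longrightarrow> s \<le> t \<Longrightarrow> \<alpha> t \<le> \<alpha> s"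
    and x1_in: "x1 \<in> X" and x_1: "\<And>\<omega>. \<omega> \<in> space M \<Longrightarrow> x 1 \<omega> = x1"
    and x_emd: "\<And>\<omega>. \<omega> \<in> space M \<Longrightarrow> emd_path X \<psi> grad \<alpha> g (\<lambda>t. \<xi> t \<omega>) (\<lambda>t. x t \<omega>)"
    and xstar_in: "xstar \<in> X"
begin

sublocale P: prob_space M by (rule prob_M)
sublocale Q: prob_space \<pi> by (rule prob_pi)

abbreviation H :: "nat \<Rightarrow> 'w measure" where "H \<equiv> past M \<pi> \<xi>"

definition f :: "'a \<Rightarrow> real" where "f z = (\<integral>s. F z s \<partial>\<pi>)"

text \<open>The truncation is inactive for \<open>\<pi>\<close>-almost every sample and, almost surely, along the process;
  it makes the function bounded also for the samples that only the kernels \<open>K s t\<close> can charge.\<close>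

definition \<phi> :: "'a \<Rightarrow> 'x \<Rightarrow> real" where
  "\<phi> z s = max (- (G * R)) (min (G * R) (F z s - F xstar s))"

text \<open>\<open>x (Suc i)\<close> depends on the first \<open>i\<close> samples only, so
  \<open>i\<close> is the time of conditioning and the sample \<open>\<xi> (i + k)\<close> lies
  \<open>k\<close> steps ahead of it.\<close>

definition drift :: "nat \<Rightarrow> nat \<Rightarrow> 'w \<Rightarrow> real" where
  "drift k i \<omega> = (\<integral>s. \<phi> (x (Suc i) \<omega>) s \<partial>K i (i + k) \<omega>)"

definition noise :: "nat \<Rightarrow> nat \<Rightarrow> 'w \<Rightarrow> real" where
  "noise k i \<omega> = drift k i \<omega> - \<phi> (x (Suc i) \<omega>) (\<xi> (i + k) \<omega>)"

lemma x_step: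
  assumes "\<omega> \<in> space M" "1 \<le> t"
  shows "is_arg_min (\<lambda>z. g (x t \<omega>) (\<xi> t \<omega>) \<bullet> z + bregman \<psi> grad z (x t \<omega>) / \<alpha> t)
           (\<lambda>z. z \<in> X) (x (Suc t) \<omega>)"
  using x_emd[OF assms(1)] assms(2) by (simp add: emd_path_def)

lemma x_in:
  assumes \<omega>: "\<omega> \<in> space M" and t: "1 \<le> t"
  shows "x t \<omega> \<in> X"
  using t
proof (induction t rule: dec_induct)
  case base
  then show ?case using x_1[OF \<omega>] x1_in by simp
next
  case (step t)
  then show ?case using x_step[OF \<omega>, of t] by (simp add: is_arg_min_def)
qed

lemma xi_in: "\<omega> \<in> space M \<Longrightarrow> 1 \<le> t \<Longrightarrow> \<xi> t \<omega> \<in> space \<pi>"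
  using xi_measurable[of t] by (rule measurable_space)

lemma diam: "y \<in> X \<Longrightarrow> z \<in> X \<Longrightarrow> n (y - z) \<le> R"
  using bregman_ge[OF norm_n strong, of y z] bregman_le[of y z] R_nonneg
  by (auto intro: power2_le_imp_le)

lemma space_past [simp]: "space (H s) = space M"
  by (auto simp: past_def space_measure_of_conv)

lemma sets_past:
  "sets (H s) = sigma_sets (space M) {\<xi> i -` A \<inter> space M |i A. i \<in> {1..s} \<and> A \<in> sets \<pi>}"
  unfolding past_def by (rule sets_measure_of) auto

lemma subalgebra_past: "subalgebra M (H s)"
proof -
  have "{\<xi> i -` A \<inter> space M |i A. i \<in> {1..s} \<and> A \<in> sets \<pi>} \<subseteq> sets M"
    using xi_measurable by (auto intro: measurable_sets)
  then have "sets (H s) \<subseteq> sets M" unfolding sets_past by (rule sets.sigma_sets_subset)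
  then show ?thesis by (simp add: subalgebra_def)
qed

lemma subalgebra_past_mono:
  assumes "s \<le> t" shows "subalgebra (H t) (H s)"
  using assms unfolding subalgebra_def sets_past
  by (auto intro!: sigma_sets_mono' simp del: atLeastAtMost_iff) force

lemma xi_past:
  assumes "1 \<le> t" "t \<le> s" shows "\<xi> t \<in> H s \<rightarrow>\<^sub>M \<pi>"
proof (rule measurableI)
  show "\<xi> t \<omega> \<in> space \<pi>" if "\<omega> \<in> space (H s)" for \<omega> using that xi_in assms by simp
  show "\<xi> t -` A \<inter> space (H s) \<in> sets (H s)" if "A \<in> sets \<pi>" for A
    using that assms by (auto simp: sets_past intro!: sigma_sets.Basic)
qed

lemma psi_continuous: "continuous_on X \<psi>"
  using gradient unfolding gradient_on_def by (intro has_derivative_continuous_on) auto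

text \<open>\<open>grad\<close> itself may fail to be Borel, for instance in directions normal to a
  set \<open>X\<close> with empty interior. Its pairing with directions into \<open>X\<close> is
  determined by \<open>\<psi>\<close> and is a limit of continuous difference quotients.\<close>

lemma grad_measurable:
  assumes z: "z \<in> X"
  shows "(\<lambda>y. grad y \<bullet> (z - y)) \<in> borel_measurable (restrict_space borel X)"
proof (rule borel_measurable_LIMSEQ_real)
  fix y assume "y \<in> space (restrict_space borel X)"
  then have "y \<in> X" by (simp add: space_restrict_space)
  then show "(\<lambda>i. real (Suc i) * (\<psi> (y + (1 / real (Suc i)) *\<^sub>R (z - y)) - \<psi> y)) \<longlonglongrightarrow> grad y \<bullet> (z - y)"
    by (rule gradient_on_direction[OF convex_X gradient _ z])
next
  fix i
  define c where "c = 1 / real (Suc i)"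
  have c: "0 \<le> c" "c \<le> 1" by (auto simp: c_def)
  have "y + c *\<^sub>R (z - y) \<in> X" if "y \<in> X" for y
    using convexD_alt[OF convex_X that z c] by (simp add: algebra_simps)
  then have "continuous_on X (\<lambda>y. real (Suc i) * (\<psi> (y + c *\<^sub>R (z - y)) - \<psi> y))"
    by (intro continuous_intros psi_continuous continuous_on_compose2[OF psi_continuous]) auto
  then show "(\<lambda>y. real (Suc i) * (\<psi> (y + (1 / real (Suc i)) *\<^sub>R (z - y)) - \<psi> y))
      \<in> borel_measurable (restrict_space borel X)"
    unfolding c_def by (rule borel_measurable_continuous_on_restrict)
qed

text \<open>Adaptedness is derived from uniqueness of the minimiser in the quantitative form of
  \<open>mirror_step_growth\<close>. The Euclidean growth constant combines the factor
  \<open>1 / (2 * \<alpha> (Suc t))\<close> from there with the norm comparison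
  \<open>c * norm v \<le> n v\<close>.\<close>

lemma x_measurable: "x (Suc t) \<in> borel_measurable (H t)"
proof (induction t)
  case 0
  have "(\<lambda>_. x1) \<in> borel_measurable (H 0)" by simp
  then show ?case by (rule measurable_cong[THEN iffD1, rotated]) (use x_1 in simp)
next
  case (Suc t)
  define y where "y = x (Suc t)"
  have "y \<in> borel_measurable (H (Suc t))"
    unfolding y_def by (rule measurable_from_subalg[OF subalgebra_past_mono Suc.IH]) simp
  then have y[measurable]: "y \<in> H (Suc t) \<rightarrow>\<^sub>M restrict_space borel X"
    by (intro measurable_restrict_space2) (auto simp: y_def x_in)
  have xi[measurable]: "\<xi> (Suc t) \<in> H (Suc t) \<rightarrow>\<^sub>M \<pi>" by (rule xi_past) auto
  have v[measurable]: "(\<lambda>\<omega>. g (y \<omega>) (\<xi> (Suc t) \<omega>)) \<in> borel_measurable (H (Suc t))"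
    using measurable_compose[OF measurable_Pair[OF y xi] g_measurable] by simp
  have psi_y[measurable]: "(\<lambda>\<omega>. \<psi> (y \<omega>)) \<in> borel_measurable (H (Suc t))"
    by (rule measurable_compose[OF y borel_measurable_continuous_on_restrict[OF psi_continuous]])
  obtain c where c: "0 < c" "\<And>v. c * norm v \<le> n v" by (rule is_norm_lower_bound[OF norm_n]) blast
  have a: "0 < \<alpha> (Suc t)" by (rule alpha_pos) simp
  show ?case
  proof (rule measurable_arg_min_growth
      [where \<Phi> = "\<lambda>\<omega> z. g (y \<omega>) (\<xi> (Suc t) \<omega>) \<bullet> z + bregman \<psi> grad z (y \<omega>) / \<alpha> (Suc t)"
         and c = "c\<^sup>2 / (2 * \<alpha> (Suc t))" and X = X])
    fix z assume z: "z \<in> X"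
    have [measurable]: "(\<lambda>\<omega>. grad (y \<omega>) \<bullet> (z - y \<omega>)) \<in> borel_measurable (H (Suc t))"
      by (rule measurable_compose[OF y grad_measurable[OF z]])
    show "(\<lambda>\<omega>. g (y \<omega>) (\<xi> (Suc t) \<omega>) \<bullet> z + bregman \<psi> grad z (y \<omega>) / \<alpha> (Suc t))
        \<in> borel_measurable (H (Suc t))"
      unfolding bregman_def by measurable
  next
    fix \<omega>
    show "continuous_on X (\<lambda>z. g (y \<omega>) (\<xi> (Suc t) \<omega>) \<bullet> z + bregman \<psi> grad z (y \<omega>) / \<alpha> (Suc t))"
      unfolding bregman_def using a by (intro continuous_intros psi_continuous) auto
  next
    fix \<omega> assume "\<omega> \<in> space (H (Suc t))"
    then show "x (Suc (Suc t)) \<omega> \<in> X" by (simp add: x_in)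
  next
    show "0 < c\<^sup>2 / (2 * \<alpha> (Suc t))" using c a by simp
  next
    fix \<omega> z assume "\<omega> \<in> space (H (Suc t))" and z: "z \<in> X"
    then have \<omega>: "\<omega> \<in> space M" by simp
    define u where "u = x (Suc (Suc t)) \<omega>"
    have "c\<^sup>2 / (2 * \<alpha> (Suc t)) * (norm (z - u))\<^sup>2 = (c * norm (z - u))\<^sup>2 / (2 * \<alpha> (Suc t))"
      by (simp add: power_mult_distrib)
    also have "\<dots> \<le> (n (z - u))\<^sup>2 / (2 * \<alpha> (Suc t))"
      using c a by (intro divide_right_mono power_mono) auto
    finally show "g (y \<omega>) (\<xi> (Suc t) \<omega>) \<bullet> u + bregman \<psi> grad u (y \<omega>) / \<alpha> (Suc t)
        + c\<^sup>2 / (2 * \<alpha> (Suc t)) * (norm (z - u))\<^sup>2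
        \<le> g (y \<omega>) (\<xi> (Suc t) \<omega>) \<bullet> z + bregman \<psi> grad z (y \<omega>) / \<alpha> (Suc t)"
      using mirror_step_growth[OF convex_X gradient a norm_n strong _ _ z,
          of "y \<omega>" "g (y \<omega>) (\<xi> (Suc t) \<omega>)" u] x_step[OF \<omega>, of "Suc t"] x_in[OF \<omega>, of "Suc t"]
      by (simp add: u_def y_def)
  qed
qed

lemma x_restrict: "x (Suc t) \<in> H t \<rightarrow>\<^sub>M restrict_space borel X"
  by (intro measurable_restrict_space2 x_measurable) (auto simp: x_in)

text \<open>\<open>F\<close> is only assumed measurable in the sample.  Joint measurability comes from that of \<open>g\<close>:
  on a segment the Riemann sums of the subgradients recover the increments of a convex function.\<close>

lemma F_diff_measurable:
  "(\<lambda>(z, s). F z s - F xstar s) \<in> borel_measurable (restrict_space borel X \<Otimes>\<^sub>M \<pi>)"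
proof (rule borel_measurable_LIMSEQ_real)
  define p where "p i j z = xstar + (real j / real (Suc i)) *\<^sub>R (z - xstar)" for i j :: nat and z
  define L where "L i = (\<lambda>(z, s). (\<Sum>j<Suc i. g (p i j z) s \<bullet> (z - xstar)) / real (Suc i))" for i
  fix zs assume "zs \<in> space (restrict_space borel X \<Otimes>\<^sub>M \<pi>)"
  then obtain z s where zs: "zs = (z, s)" "z \<in> X" "s \<in> space \<pi>"
    by (auto simp: space_pair_measure space_restrict_space)
  show "(\<lambda>i. L i zs) \<longlonglongrightarrow> (case zs of (z, s) \<Rightarrow> F z s - F xstar s)"
    using subgradient_riemann_sum[OF convex_X xstar_in zs(2), where h = "\<lambda>z. F z s" and g = "\<lambda>z. g z s"]
      subgradient[OF _ _ zs(3)] by (simp add: L_def p_def zs(1) del: sum.lessThan_Suc)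
next
  fix i
  show "(\<lambda>(z, s). (\<Sum>j<Suc i. g (xstar + (real j / real (Suc i)) *\<^sub>R (z - xstar)) s \<bullet> (z - xstar)) / real (Suc i))
      \<in> borel_measurable (restrict_space borel X \<Otimes>\<^sub>M \<pi>)"
  proof -
    let ?N = "restrict_space borel X \<Otimes>\<^sub>M \<pi>"
    have fst_b[measurable]: "fst \<in> ?N \<rightarrow>\<^sub>M borel"
      by (rule measurable_compose[OF measurable_fst, of "\<lambda>z. z", simplified])
        (rule measurable_restrict_space1, simp)
    have "(\<lambda>zs. g (xstar + (real j / real (Suc i)) *\<^sub>R (fst zs - xstar)) (snd zs)) \<in> ?N \<rightarrow>\<^sub>M borel"
      if j: "j < Suc i" for j
    proof -
      have "(\<lambda>zs. xstar + (real j / real (Suc i)) *\<^sub>R (fst zs - xstar)) \<in> ?N \<rightarrow>\<^sub>M restrict_space borel X"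
      proof (rule measurable_restrict_space2)
        show "(\<lambda>zs. xstar + (real j / real (Suc i)) *\<^sub>R (fst zs - xstar)) \<in> space ?N \<rightarrow> X"
        proof
          fix zs assume "zs \<in> space ?N"
          then have "fst zs \<in> X" by (auto simp: space_pair_measure space_restrict_space)
          from convexD_alt[OF convex_X xstar_in this, of "real j / real (Suc i)"]
          show "xstar + (real j / real (Suc i)) *\<^sub>R (fst zs - xstar) \<in> X"
            using j by (simp add: algebra_simps divide_le_eq_1)
        qed
      qed measurable
      from measurable_compose[OF measurable_Pair[OF this measurable_snd] g_measurable]
      show ?thesis by simp
    qed
    then have "(\<lambda>zs. (\<Sum>j<Suc i. g (xstar + (real j / real (Suc i)) *\<^sub>R (fst zs - xstar)) (snd zs)
        \<bullet> (fst zs - xstar)) / real (Suc i)) \<in> ?N \<rightarrow>\<^sub>M borel"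
      by (intro borel_measurable_divide borel_measurable_sum borel_measurable_inner
          borel_measurable_diff) (auto intro: fst_b)
    then show ?thesis by (simp add: case_prod_beta del: sum.lessThan_Suc)
  qed
qed

lemma phi_measurable: "(\<lambda>(z, s). \<phi> z s) \<in> borel_measurable (restrict_space borel X \<Otimes>\<^sub>M \<pi>)"
proof -
  note [measurable] = F_diff_measurable
  have "(\<lambda>zs. max (- (G * R)) (min (G * R) ((\<lambda>(z, s). F z s - F xstar s) zs)))
      \<in> borel_measurable (restrict_space borel X \<Otimes>\<^sub>M \<pi>)"
    by measurable
  then show ?thesis by (simp add: \<phi>_def case_prod_beta)
qed

lemma GR_nonneg: "0 \<le> G * R"
  using G_nonneg R_nonneg by simp

lemma phi_bound: "\<bar>\<phi> z s\<bar> \<le> G * R"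
  using GR_nonneg by (auto simp: \<phi>_def)

lemma phi_measurable_right:
  assumes z: "z \<in> X" shows "\<phi> z \<in> borel_measurable \<pi>"
proof -
  have "Pair z \<in> \<pi> \<rightarrow>\<^sub>M restrict_space borel X \<Otimes>\<^sub>M \<pi>" 
    using z by (intro measurable_Pair1') (simp add: space_restrict_space)
  from measurable_compose[OF this phi_measurable] show ?thesis by simp
qed

lemma phi_eq:
  assumes "z \<in> X" "\<bar>F z s - F xstar s\<bar> \<le> G * n (z - xstar)"
  shows "\<phi> z s = F z s - F xstar s"
proof -
  have "G * n (z - xstar) \<le> G * R"
    using diam[OF assms(1) xstar_in] G_nonneg by (rule mult_left_mono)
  then show ?thesis using assms(2) by (auto simp: \<phi>_def)
qed

lemma integral_phi:
  assumes z: "z \<in> X" shows "(\<integral>s. \<phi> z s \<partial>\<pi>) = f z - f xstar"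
proof -
  have "(\<integral>s. \<phi> z s \<partial>\<pi>) = (\<integral>s. F z s - F xstar s \<partial>\<pi>)"
  proof (rule integral_cong_AE)
    show "AE s in \<pi>. \<phi> z s = F z s - F xstar s"
      using F_lipschitz by eventually_elim (use z xstar_in phi_eq in blast)
  qed (use phi_measurable_right[OF z] F_integrable z xstar_in in \<open>auto intro: borel_measurable_integrable\<close>)
  also have "\<dots> = f z - f xstar" using F_integrable z xstar_in by (simp add: f_def)
  finally show ?thesis .
qed

lemma f_lipschitz:
  assumes y: "y \<in> X" and z: "z \<in> X"
  shows "\<bar>f y - f z\<bar> \<le> G * n (y - z)"
proof -
  have "f y - f z = (\<integral>s. F y s - F z s \<partial>\<pi>)" using F_integrable y z by (simp add: f_def)
  also have "\<bar>\<dots>\<bar> \<le> (\<integral>s. \<bar>F y s - F z s\<bar> \<partial>\<pi>)" by (rule integral_abs_bound)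
  also have "\<dots> \<le> G * n (y - z)"
  proof (rule Q.integral_le_const)
    show "AE s in \<pi>. \<bar>F y s - F z s\<bar> \<le> G * n (y - z)"
      using F_lipschitz by eventually_elim (use y z in blast)
  qed (use F_integrable y z in auto)
  finally show ?thesis .
qed

lemma f_diff_le:
  assumes "y \<in> X" "z \<in> X" shows "f y - f z \<le> G * R"
  using f_lipschitz[OF assms] mult_left_mono[OF diam[OF assms] G_nonneg] by linarith

text \<open>Jensen's inequality, obtained for each sample by summing the subgradient inequalities at
  the mean: the displacements from the mean add up to zero. Integration over the sample comes last,
  so no subgradient of \<open>f\<close> has to be constructed.\<close>

lemma f_average:
  assumes T: "1 \<le> T" and y: "\<And>t. t \<in> {1..T} \<Longrightarrow> y t \<in> X"
  shows "(1 / real T) *\<^sub>R (\<Sum>t=1..T. y t) \<in> X"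
    and "real T * (f ((1 / real T) *\<^sub>R (\<Sum>t=1..T. y t)) - f xstar) \<le> (\<Sum>t=1..T. f (y t) - f xstar)"
proof -
  define m where "m = (1 / real T) *\<^sub>R (\<Sum>t=1..T. y t)"
  have "(\<Sum>t\<in>{1..T}. (1 / real T) *\<^sub>R y t) \<in> X"
    by (rule convex_sum[OF _ convex_X]) (use T y in auto)
  then show m: "(1 / real T) *\<^sub>R (\<Sum>t=1..T. y t) \<in> X" by (simp add: scaleR_sum_right)
  have "real T * f m = (\<integral>s. real T * F m s \<partial>\<pi>)" by (simp add: f_def)
  also have "\<dots> \<le> (\<integral>s. (\<Sum>t=1..T. F (y t) s) \<partial>\<pi>)"
  proof (rule integral_mono)
    fix s assume s: "s \<in> space \<pi>"
    have "(\<Sum>t=1..T. F m s + g m s \<bullet> (y t - m)) \<le> (\<Sum>t=1..T. F (y t) s)"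
      by (rule sum_mono) (use subgradient m y s m_def in auto)
    moreover have "(\<Sum>t=1..T. F m s + g m s \<bullet> (y t - m)) = real T * F m s + g m s \<bullet> ((\<Sum>t=1..T. y t) - real T *\<^sub>R m)"
      by (simp add: sum.distrib inner_sum_right[symmetric] sum_subtractf sum_constant_scaleR)
    moreover have "(\<Sum>t=1..T. y t) - real T *\<^sub>R m = 0" using T by (simp add: m_def)
    ultimately show "real T * F m s \<le> (\<Sum>t=1..T. F (y t) s)" by simp
  qed (use m m_def y F_integrable in auto)
  also have "\<dots> = (\<Sum>t=1..T. f (y t))"
    unfolding f_def by (rule Bochner_Integration.integral_sum) (use y F_integrable in auto)
  finally show "real T * (f ((1 / real T) *\<^sub>R (\<Sum>t=1..T. y t)) - f xstar) \<le> (\<Sum>t=1..T. f (y t) - f xstar)"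
    by (simp add: m_def sum_subtractf right_diff_distrib)
qed

end

section \<open>Noise at a fixed lag: conditional mean, bounds and tail\<close>

lemma sum_residue_classes:
  fixes h :: "nat \<Rightarrow> 'b::comm_monoid_add"
  shows "(\<Sum>i<q * k. h i) = (\<Sum>j<k. \<Sum>m<q. h (m * k + j))"
proof -
  have "(\<Sum>i<q * k. h i) = (\<Sum>m<q. sum h {m * k..<m * k + k})"
    by (rule sum.nat_group[symmetric])
  also have "\<dots> = (\<Sum>m<q. \<Sum>j<k. h (m * k + j))"
  proof (rule sum.cong)
    fix m
    show "sum h {m * k..<m * k + k} = (\<Sum>j<k. h (m * k + j))"
      using sum.shift_bounds_nat_ivl[of h 0 "m * k" k] by (simp add: atLeast0LessThan add.commute)
  qed simp
  also have "\<dots> = (\<Sum>j<k. \<Sum>m<q. h (m * k + j))" by (rule sum.swap)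
  finally show ?thesis .
qed

context ergodic_mirror_descent
begin

context
  fixes k i :: nat
  assumes k: "1 \<le> k"
begin

lemma kernel_step: "cond_distribution M (H i) \<pi> (\<xi> (i + k)) (K i (i + k))"
  by (rule kernel) (use k in simp)

lemma xi_step: "\<xi> (i + k) \<in> M \<rightarrow>\<^sub>M \<pi>"
  by (rule xi_measurable) (use k in simp)

lemmas step_kernel = cond_distribution_prob_space[OF prob_M subalgebra_past xi_step kernel_step]

lemma phi_x_measurable: "(\<lambda>(\<omega>, s). \<phi> (x (Suc i) \<omega>) s) \<in> borel_measurable (H i \<Otimes>\<^sub>M \<pi>)"
proof -
  have "(\<lambda>\<omega>s. (x (Suc i) (fst \<omega>s), snd \<omega>s)) \<in> H i \<Otimes>\<^sub>M \<pi> \<rightarrow>\<^sub>M restrict_space borel X \<Otimes>\<^sub>M \<pi>"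
    by (intro measurable_Pair measurable_compose[OF measurable_fst x_restrict] measurable_snd)
  from measurable_compose[OF this phi_measurable] show ?thesis by (simp add: case_prod_beta)
qed

lemma drift_measurable: "drift k i \<in> borel_measurable (H i)"
  unfolding drift_def[abs_def]
  by (rule cond_distribution_integral(1)[OF prob_M subalgebra_past xi_step kernel_step phi_x_measurable phi_bound])

lemma phi_step_measurable:
  "(\<lambda>\<omega>. \<phi> (x (Suc i) \<omega>) (\<xi> (i + k) \<omega>)) \<in> borel_measurable (H (i + k))"
proof -
  have "x (Suc i) \<in> H (i + k) \<rightarrow>\<^sub>M restrict_space borel X"
    by (rule measurable_from_subalg[OF subalgebra_past_mono x_restrict]) simp
  from measurable_compose[OF measurable_Pair[OF this xi_past] phi_measurable, of "i + k"] k
  show ?thesis by simp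
qed

lemma noise_measurable: "noise k i \<in> borel_measurable (H (i + k))"
proof -
  have "drift k i \<in> borel_measurable (H (i + k))"
    by (rule measurable_from_subalg[OF subalgebra_past_mono drift_measurable]) simp
  then show ?thesis unfolding noise_def[abs_def] by (intro borel_measurable_diff phi_step_measurable)
qed

lemma drift_bound:
  assumes \<omega>: "\<omega> \<in> space M" shows "\<bar>drift k i \<omega>\<bar> \<le> G * R"
proof -
  interpret K: prob_space "K i (i + k) \<omega>" by (rule step_kernel(1)[OF \<omega>])
  have [measurable]: "\<phi> (x (Suc i) \<omega>) \<in> borel_measurable (K i (i + k) \<omega>)"
    using phi_measurable_right[OF x_in[OF \<omega>, of "Suc i"]] step_kernel(2)[OF \<omega>]
    by (simp cong: measurable_cong_sets)
  have "\<bar>drift k i \<omega>\<bar> \<le> (\<integral>s. \<bar>\<phi> (x (Suc i) \<omega>) s\<bar> \<partial>K i (i + k) \<omega>)"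
    unfolding drift_def by (rule integral_abs_bound)
  also have "\<dots> \<le> G * R"
    by (rule K.integral_le_const) (auto intro!: phi_bound K.integrable_const_bound[of _ "G * R"])
  finally show ?thesis .
qed

lemma noise_bound:
  assumes "\<omega> \<in> space M" shows "\<bar>noise k i \<omega>\<bar> \<le> 2 * G * R"
  using drift_bound[OF assms] phi_bound[of "x (Suc i) \<omega>" "\<xi> (i + k) \<omega>"] by (simp add: noise_def)

text \<open>Since \<open>W\<close> is known at time \<open>i\<close>, it can be put into the
  integrand of the freezing rule and pulled out of the kernel integral again. Conditional mean zero
  thus appears in the tested form that \<open>azuma\<close> takes.\<close>

lemma noise_orthogonal:
  assumes W: "W \<in> borel_measurable (H i)" and c: "\<And>\<omega>. \<omega> \<in> space M \<Longrightarrow> \<bar>W \<omega>\<bar> \<le> c"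
  shows "P.expectation (\<lambda>\<omega>. W \<omega> * noise k i \<omega>) = 0"
proof -
  have Wphi: "(\<lambda>(\<omega>, s). W \<omega> * \<phi> (x (Suc i) \<omega>) s) \<in> borel_measurable (H i \<Otimes>\<^sub>M \<pi>)"
    using borel_measurable_times[OF measurable_compose[OF measurable_fst W] phi_x_measurable]
    by (simp add: case_prod_beta)
  have bnd: "\<bar>W \<omega> * \<phi> z s\<bar> \<le> c * (G * R)" if "\<omega> \<in> space M" for \<omega> z s
    unfolding abs_mult using c[OF that] phi_bound by (intro mult_mono) auto
  have bnd': "\<bar>W \<omega> * drift k i \<omega>\<bar> \<le> c * (G * R)" if "\<omega> \<in> space M" for \<omega>
    unfolding abs_mult using c[OF that] drift_bound[OF that] by (intro mult_mono) auto
  have WM[measurable]: "W \<in> borel_measurable M" by (rule measurable_from_subalg[OF subalgebra_past W])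
  have [measurable]: "drift k i \<in> borel_measurable M"
    by (rule measurable_from_subalg[OF subalgebra_past drift_measurable])
  have [measurable]: "(\<lambda>\<omega>. \<phi> (x (Suc i) \<omega>) (\<xi> (i + k) \<omega>)) \<in> borel_measurable M"
    by (rule measurable_from_subalg[OF subalgebra_past phi_step_measurable])
  have i1: "integrable M (\<lambda>\<omega>. W \<omega> * drift k i \<omega>)"
    by (rule P.integrable_const_bound[of _ "c * (G * R)"]) (use bnd' in auto)
  have i2: "integrable M (\<lambda>\<omega>. W \<omega> * \<phi> (x (Suc i) \<omega>) (\<xi> (i + k) \<omega>))"
    by (rule P.integrable_const_bound[of _ "c * (G * R)"]) (use bnd in auto)
  have "(\<integral>\<omega>. W \<omega> * \<phi> (x (Suc i) \<omega>) (\<xi> (i + k) \<omega>) \<partial>M)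
      = (\<integral>\<omega>. (\<integral>s. W \<omega> * \<phi> (x (Suc i) \<omega>) s \<partial>K i (i + k) \<omega>) \<partial>M)"
    by (rule cond_distribution_integral(2)[OF prob_M subalgebra_past xi_step kernel_step Wphi bnd])
  also have "\<dots> = (\<integral>\<omega>. W \<omega> * drift k i \<omega> \<partial>M)" by (simp add: drift_def)
  finally show ?thesis using i1 i2 by (simp add: noise_def right_diff_distrib)
qed

lemma drift_mixed:
  assumes \<omega>: "\<omega> \<in> space M" and mixed: "d_TV (K i (i + k) \<omega>) \<pi> \<le> \<epsilon>"
  shows "f (x (Suc i) \<omega>) - f xstar \<le> drift k i \<omega> + \<epsilon> * (G * R)"
proof -
  have z: "x (Suc i) \<omega> \<in> X" by (rule x_in[OF \<omega>]) simp
  have "\<bar>drift k i \<omega> - (\<integral>s. \<phi> (x (Suc i) \<omega>) s \<partial>\<pi>)\<bar> \<le> G * R * d_TV (K i (i + k) \<omega>) \<pi>"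
    unfolding drift_def
    by (rule integral_diff_le_d_TV[OF step_kernel(1)[OF \<omega>] prob_pi])
      (use step_kernel(2)[OF \<omega>] phi_measurable_right[OF z] phi_bound in \<open>auto cong: measurable_cong_sets\<close>)
  also have "\<dots> \<le> G * R * \<epsilon>" by (rule mult_left_mono[OF mixed GR_nonneg])
  finally show ?thesis using integral_phi[OF z] by (simp add: mult_ac)
qed

end

text \<open>Along each residue class modulo \<open>k\<close> the noise is a martingale difference sequence.  The class
  sums are handled by a union bound with threshold \<open>u\<close>, for which each class exceeds it with
  probability at most \<open>(\<delta> / k)\<^sup>2\<close>.\<close>

lemma noise_tail:
  assumes k: "1 \<le> k" "k \<le> T" and GR: "0 < G * R" and \<delta>: "0 < \<delta>" "\<delta> < 1"
  shows "P.prob {\<omega> \<in> space M. 4 * (G * R) * sqrt (real k * real T * ln (real k / \<delta>)) \<le> (\<Sum>i<Suc T - k. noise k i \<omega>)} \<le> \<delta>"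
proof -
  define q where "q = T div k"
  \<comment> \<open>Padding with zeros gives every residue class exactly \<open>q\<close> terms.
    This covers all the noise because \<open>T < q * k + k\<close> implies
    \<open>Suc T - k \<le> q * k\<close>.\<close>
  define E where "E i = (if i < Suc T - k then noise k i else (\<lambda>_. 0))" for i
  define S where "S j \<omega> = (\<Sum>m<q. E (m * k + j) \<omega>)" for j \<omega>
  define l where "l = ln (real k / \<delta>)"
  \<comment> \<open>The threshold for the whole sum shared equally among the \<open>k\<close>
    classes: if every class stays below \<open>u\<close>, the total stays below the
    threshold.\<close>
  define u where "u = 4 * (G * R) * sqrt (real k * real T * l) / real k"
  have q: "0 < q" using k by (simp add: q_def div_greater_zero_iff)
  have qk: "q * k \<le> T" by (simp add: q_def)
  have l: "0 \<le> l" unfolding l_def using k \<delta> by (intro ln_ge_zero) (simp add: field_simps)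
  have E_meas: "E i \<in> borel_measurable (H (i + k))" for i
    using noise_measurable[OF k(1)] by (simp add: E_def)
  have E_measM[measurable]: "E i \<in> borel_measurable M" for i
    by (rule measurable_from_subalg[OF subalgebra_past E_meas])
  have E_bound: "\<bar>E i \<omega>\<bar> \<le> 2 * G * R" if "\<omega> \<in> space M" for i \<omega>
    using noise_bound[OF k(1) that] GR by (auto simp: E_def)
  have sum_D: "(\<Sum>i<Suc T - k. noise k i \<omega>) = (\<Sum>j<k. S j \<omega>)" for \<omega>
  proof -
    have "T < q * k + k"
      using mod_less_divisor[of k T] div_mult_mod_eq[of T k] k unfolding q_def by linarith
    then have "Suc T - k \<le> q * k" by simp
    then have "(\<Sum>i<q * k. E i \<omega>) = (\<Sum>i<Suc T - k. E i \<omega>)"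
      by (intro sum.mono_neutral_right) (auto simp: E_def)
    also have "\<dots> = (\<Sum>i<Suc T - k. noise k i \<omega>)" by (simp add: E_def)
    finally show ?thesis unfolding S_def by (subst sum_residue_classes[symmetric]) simp
  qed
  have S_meas[measurable]: "S j \<in> borel_measurable M" for j unfolding S_def[abs_def] by measurable
  have tail: "P.prob {\<omega> \<in> space M. u \<le> S j \<omega>} \<le> (\<delta> / real k)\<^sup>2" for j
  proof -
    have "P.prob {\<omega> \<in> space M. u \<le> (\<Sum>m<q. E (m * k + j) \<omega>)} \<le> exp (- u\<^sup>2 / (2 * real q * (2 * G * R)\<^sup>2))"
    proof (rule P.azuma)
      fix m and b :: real assume "0 \<le> b"
      have sum_bound: "(\<Sum>r<m. E (r * k + j) \<omega>) \<le> real m * (2 * G * R)" if "\<omega> \<in> space M" for \<omega>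
        using sum_bounded_above[of "{..<m}" "\<lambda>r. E (r * k + j) \<omega>" "2 * G * R"] E_bound[OF that]
        by (simp add: abs_le_iff)
      have "P.expectation (\<lambda>\<omega>. exp (b * (\<Sum>r<m. E (r * k + j) \<omega>)) * noise k (m * k + j) \<omega>) = 0"
      proof (rule noise_orthogonal[OF k(1)])
        \<comment> \<open>Members of a class are \<open>k\<close> apart, exactly the lag. The sample
          used by an earlier term is therefore already known when a later term is conditioned, which
          fails for consecutive terms if \<open>k > 1\<close>.\<close>
        have "E (r * k + j) \<in> borel_measurable (H (m * k + j))" if "r < m" for r
        proof (rule measurable_from_subalg[OF subalgebra_past_mono E_meas])
          have "Suc r * k \<le> m * k" using that by (intro mult_le_mono1) simp
          then show "r * k + j + k \<le> m * k + j" by simp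
        qed
        then have "(\<lambda>\<omega>. \<Sum>r<m. E (r * k + j) \<omega>) \<in> borel_measurable (H (m * k + j))"
          by (intro borel_measurable_sum) auto
        then show "(\<lambda>\<omega>. exp (b * (\<Sum>r<m. E (r * k + j) \<omega>))) \<in> borel_measurable (H (m * k + j))"
          by measurable
        show "\<bar>exp (b * (\<Sum>r<m. E (r * k + j) \<omega>))\<bar> \<le> exp (b * (real m * (2 * G * R)))"
          if "\<omega> \<in> space M" for \<omega>
          using mult_left_mono[OF sum_bound[OF that] \<open>0 \<le> b\<close>] by simp
      qed
      then show "P.expectation (\<lambda>\<omega>. exp (b * (\<Sum>r<m. E (r * k + j) \<omega>)) * E (m * k + j) \<omega>) \<le> 0"
        by (cases "m * k + j < Suc T - k") (simp_all add: E_def)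
    qed (use E_bound GR q l k in \<open>auto simp: u_def\<close>)
    \<comment> \<open>The constant 4 meets the increment bound \<open>2 * G * R\<close> here:
      \<open>u\<^sup>2\<close> is \<open>16 * (G * R)\<^sup>2 * T * l / k\<close> against the
      denominator \<open>8 * q * (G * R)\<^sup>2\<close>, so the exponent is
      \<open>2 * l * T / (q * k)\<close>, and \<open>q * k \<le> T\<close> leaves at least
      \<open>2 * l\<close>.\<close>
    also have "\<dots> \<le> exp (- 2 * l)"
    proof -
      have "u\<^sup>2 = 16 * (G * R)\<^sup>2 * (real T * l) / real k"
      proof -
        have "u\<^sup>2 = (4 * (G * R))\<^sup>2 * (real k * real T * l) / (real k)\<^sup>2"
          unfolding u_def power_divide power_mult_distrib[of "4 * (G * R)"] using l by simp
        then show ?thesis using k by (simp add: power_mult_distrib power2_eq_square[of "real k"])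
      qed
      then have "u\<^sup>2 / (2 * real q * (2 * G * R)\<^sup>2) = 2 * l * (real T / (real q * real k))"
      proof -
        define c where "c = (G * R)\<^sup>2"
        have "0 < c" unfolding c_def using GR by (rule zero_less_power)
        moreover have "(2 * G * R)\<^sup>2 = 4 * c" by (simp add: c_def power_mult_distrib)
        moreover have "16 * c * (real T * l) / real k / (2 * real q * (4 * c)) = 2 * l * (real T / (real q * real k))"
          using \<open>0 < c\<close> q k by (simp add: divide_simps)
        moreover note \<open>u\<^sup>2 = 16 * (G * R)\<^sup>2 * (real T * l) / real k\<close>[folded c_def]
        ultimately show ?thesis by simp
      qed
      moreover have "2 * l * 1 \<le> 2 * l * (real T / (real q * real k))"
      proof (rule mult_left_mono)
        have "real q * real k \<le> real T" using qk by (metis of_nat_le_iff of_nat_mult)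
        then show "1 \<le> real T / (real q * real k)" using q k by simp
      qed (use l in simp)
      ultimately show ?thesis by simp
    qed
    also have "exp (- 2 * l) = (exp (- l))\<^sup>2" by (simp add: power2_eq_square exp_add[symmetric])
    also have "exp (- l) = \<delta> / real k" using k \<delta> by (simp add: l_def exp_minus)
    finally show ?thesis by (simp add: S_def)
  qed
  have "P.prob {\<omega> \<in> space M. 4 * (G * R) * sqrt (real k * real T * l) \<le> (\<Sum>i<Suc T - k. noise k i \<omega>)}
      \<le> P.prob (\<Union>j<k. {\<omega> \<in> space M. u \<le> S j \<omega>})"
  proof (rule P.finite_measure_mono)
    show "{\<omega> \<in> space M. 4 * (G * R) * sqrt (real k * real T * l) \<le> (\<Sum>i<Suc T - k. noise k i \<omega>)}
        \<subseteq> (\<Union>j<k. {\<omega> \<in> space M. u \<le> S j \<omega>})"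
    proof (rule subsetI, rule ccontr)
      fix \<omega> assume \<omega>: "\<omega> \<in> {\<omega> \<in> space M. 4 * (G * R) * sqrt (real k * real T * l) \<le> (\<Sum>i<Suc T - k. noise k i \<omega>)}"
        and not: "\<omega> \<notin> (\<Union>j<k. {\<omega> \<in> space M. u \<le> S j \<omega>})"
      have "(\<Sum>j<k. S j \<omega>) < (\<Sum>j<k. u)"
        by (rule sum_strict_mono) (use \<omega> not k in \<open>auto simp: lessThan_empty_iff not_le\<close>)
      also have "\<dots> = 4 * (G * R) * sqrt (real k * real T * l)" using k by (simp add: u_def)
      finally show False using \<omega> sum_D by simp
    qed
  qed measurable
  also have "\<dots> \<le> (\<Sum>j<k. P.prob {\<omega> \<in> space M. u \<le> S j \<omega>})"
    by (rule P.finite_measure_subadditive_finite) auto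
  also have "\<dots> \<le> (\<Sum>j<k. (\<delta> / real k)\<^sup>2)" by (rule sum_mono[OF tail])
  also have "\<dots> = \<delta> * (\<delta> / real k)" using k by (simp add: power2_eq_square)
  also have "\<dots> \<le> \<delta> * 1" using k \<delta> by (intro mult_left_mono) (auto simp: field_simps)
  finally show ?thesis by (simp add: l_def)
qed

section \<open>Pathwise comparison of the averaged gap with the regret\<close>

lemma x_drift:
  assumes \<omega>: "\<omega> \<in> space M" and t: "1 \<le> t"
    and g: "\<And>t z. 1 \<le> t \<Longrightarrow> z \<in> X \<Longrightarrow> dual_norm n (g z (\<xi> t \<omega>)) \<le> G"
  shows "n (x t \<omega> - x (t + m) \<omega>) \<le> real m * (\<alpha> t * G)"
proof (induction m)
  case 0
  then show ?case by (simp add: is_norm_zero[OF norm_n])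
next
  case (Suc m)
  have "n (x (t + m) \<omega> - x (Suc (t + m)) \<omega>) \<le> \<alpha> (t + m) * G"
    by (rule mirror_step_move[OF convex_X gradient _ norm_n strong _ x_step[OF \<omega>] g])
      (use t alpha_pos x_in[OF \<omega>] in auto)
  \<comment> \<open>Stepsizes do not increase, so the earliest one bounds all later moves; summing
    over \<open>t\<close> then produces a single copy of the stepsize sum for each of the
    \<open>k - 1\<close> steps.\<close>
  also have "\<dots> \<le> \<alpha> t * G" using alpha_mono[OF t, of "t + m"] G_nonneg by (intro mult_right_mono) auto
  finally have step: "n (x (t + m) \<omega> - x (Suc (t + m)) \<omega>) \<le> \<alpha> t * G" .
  have "n ((x t \<omega> - x (t + m) \<omega>) + (x (t + m) \<omega> - x (Suc (t + m)) \<omega>))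
      \<le> n (x t \<omega> - x (t + m) \<omega>) + n (x (t + m) \<omega> - x (Suc (t + m)) \<omega>)"
    using norm_n unfolding is_norm_def by blast
  then show ?case using Suc.IH step by (simp add: algebra_simps)
qed

lemma regret_decomposition:
  assumes k: "1 \<le> k" "k \<le> T"
    and mixed: "AE \<omega> in M. \<forall>s. d_TV (K s (s + k) \<omega>) \<pi> \<le> \<epsilon>"
  shows "AE \<omega> in M. real T * (f ((1 / real T) *\<^sub>R (\<Sum>t=1..T. x t \<omega>)) - f xstar)
    \<le> (\<Sum>i<Suc T - k. noise k i \<omega>) + real T * (\<epsilon> * (G * R)) + R\<^sup>2 / (2 * \<alpha> T) + G\<^sup>2 / 2 * (\<Sum>t=1..T. \<alpha> t)
      + (real k - 1) * (G\<^sup>2 * (\<Sum>t=1..T. \<alpha> t) + G * R)"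
  using mixed g_bounded[unfolded subgradients_bounded_def] AE_space
proof eventually_elim
  case (elim \<omega>)
  then have \<omega>: "\<omega> \<in> space M" by simp
  have g: "dual_norm n (g z (\<xi> t \<omega>)) \<le> G" if "1 \<le> t" "z \<in> X" for t z using elim(2) that by simp
  define A where "A = (\<Sum>t=1..T. \<alpha> t)"
  \<comment> \<open>The number of iterates whose delayed sample is drawn by time \<open>T\<close>:
    \<open>x (Suc i)\<close> is paired with \<open>\<xi> (i + k)\<close>, and
    \<open>i + k \<le> T\<close> means \<open>i < N\<close>.\<close>
  define N where "N = Suc T - k"
  have NT: "N \<le> T" "N + k = Suc T" using k by (auto simp: N_def)
  have xX: "x (Suc i) \<omega> \<in> X" for i by (rule x_in[OF \<omega>]) simp
  \<comment> \<open>Along the process the Lipschitz bound is taken from the dual-norm bound on the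
    subgradients, because a realised sample may lie in a \<open>\<pi>\<close>-null set about which
    \<open>F_lipschitz\<close> says nothing.\<close>
  have F_sub: "F y (\<xi> t \<omega>) - F z (\<xi> t \<omega>) \<le> G * n (y - z)" if "1 \<le> t" "y \<in> X" "z \<in> X" for t y z
  proof -
    have "F y (\<xi> t \<omega>) + g y (\<xi> t \<omega>) \<bullet> (z - y) \<le> F z (\<xi> t \<omega>)"
      by (rule subgradient) (use that xi_in[OF \<omega>] in auto)
    then have "F y (\<xi> t \<omega>) - F z (\<xi> t \<omega>) \<le> g y (\<xi> t \<omega>) \<bullet> (y - z)" by (simp add: inner_diff_right)
    also have "\<dots> \<le> dual_norm n (g y (\<xi> t \<omega>)) * n (y - z)" by (rule inner_le_dual_norm[OF norm_n])
    also have "\<dots> \<le> G * n (y - z)"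
      using g[OF that(1,2)] is_norm_nonneg[OF norm_n] by (rule mult_right_mono)
    finally show ?thesis .
  qed
  have A_part: "(\<Sum>t\<in>I. \<alpha> t) \<le> A" if "I \<subseteq> {1..T}" for I
    unfolding A_def using that alpha_pos by (intro sum_mono2) (auto intro: less_imp_le)
  have A_nonneg: "0 \<le> A" using A_part[of "{}"] by simp
  have eps: "0 \<le> \<epsilon>"
  proof -
    have "0 \<le> d_TV (K 0 (0 + k) \<omega>) \<pi>" unfolding d_TV_def by (rule integral_nonneg_AE) simp
    then show ?thesis using elim(1) by (meson order_trans)
  qed

  have "real T * (f ((1 / real T) *\<^sub>R (\<Sum>t=1..T. x t \<omega>)) - f xstar) \<le> (\<Sum>t=1..T. f (x t \<omega>) - f xstar)"
    by (rule f_average(2)) (use k x_in[OF \<omega>] in auto)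
  also have "\<dots> = (\<Sum>i<T. f (x (Suc i) \<omega>) - f xstar)"
    by (simp add: sum.atLeast1_atMost_eq)
  also have "\<dots> = (\<Sum>i<N. f (x (Suc i) \<omega>) - f xstar) + (\<Sum>i=N..<T. f (x (Suc i) \<omega>) - f xstar)"
    using sum.atLeastLessThan_concat[of 0 N T "\<lambda>i. f (x (Suc i) \<omega>) - f xstar"] NT(1)
    by (simp add: atLeast0LessThan)
  finally have split: "real T * (f ((1 / real T) *\<^sub>R (\<Sum>t=1..T. x t \<omega>)) - f xstar)
      \<le> (\<Sum>i<N. f (x (Suc i) \<omega>) - f xstar) + (\<Sum>i=N..<T. f (x (Suc i) \<omega>) - f xstar)" .

  have "(\<Sum>i=N..<T. f (x (Suc i) \<omega>) - f xstar) \<le> real (card {N..<T}) * (G * R)"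
    by (rule sum_bounded_above[OF f_diff_le[OF xX xstar_in]])
  also have "real (card {N..<T}) = real k - 1" using NT by (simp add: of_nat_diff)
  finally have late: "(\<Sum>i=N..<T. f (x (Suc i) \<omega>) - f xstar) \<le> (real k - 1) * (G * R)" .

  have each: "f (x (Suc i) \<omega>) - f xstar
      \<le> noise k i \<omega> + \<epsilon> * (G * R) + (real k - 1) * G\<^sup>2 * \<alpha> (Suc i)
        + (F (x (i + k) \<omega>) (\<xi> (i + k) \<omega>) - F xstar (\<xi> (i + k) \<omega>))" for i
  proof -
    let ?s = "\<xi> (i + k) \<omega>"
    have ik: "1 \<le> i + k" using k by simp
    have "f (x (Suc i) \<omega>) - f xstar \<le> drift k i \<omega> + \<epsilon> * (G * R)"
      by (rule drift_mixed[OF k(1) \<omega>]) (use elim(1) in simp)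
    also have "drift k i \<omega> = noise k i \<omega> + \<phi> (x (Suc i) \<omega>) ?s" by (simp add: noise_def)
    also have "\<phi> (x (Suc i) \<omega>) ?s = F (x (Suc i) \<omega>) ?s - F xstar ?s"
    proof (rule phi_eq[OF xX])
      show "\<bar>F (x (Suc i) \<omega>) ?s - F xstar ?s\<bar> \<le> G * n (x (Suc i) \<omega> - xstar)"
        using F_sub[OF ik xX[of i] xstar_in] F_sub[OF ik xstar_in xX[of i]]
          is_norm_minus[OF norm_n, of xstar "x (Suc i) \<omega>"] by simp
    qed
    finally have 1: "f (x (Suc i) \<omega>) - f xstar
        \<le> noise k i \<omega> + (F (x (Suc i) \<omega>) ?s - F xstar ?s) + \<epsilon> * (G * R)" .
    \<comment> \<open>The step from the iterate that is independent of the recent samples to the one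
      at which the algorithm actually queries sample \<open>i + k\<close>; they are
      \<open>k - 1\<close> updates apart.\<close>
    have "F (x (Suc i) \<omega>) ?s - F (x (i + k) \<omega>) ?s \<le> G * n (x (Suc i) \<omega> - x (i + k) \<omega>)"
      by (rule F_sub[OF ik xX x_in[OF \<omega> ik]])
    also have "\<dots> \<le> G * (real (k - 1) * (\<alpha> (Suc i) * G))"
      using x_drift[OF \<omega> _ g, of "Suc i" "k - 1"] k G_nonneg by (intro mult_left_mono) auto
    also have "\<dots> = (real k - 1) * G\<^sup>2 * \<alpha> (Suc i)" using k by (simp add: power2_eq_square of_nat_diff)
    finally show ?thesis using 1 by linarith
  qed

  have "(\<Sum>i<N. f (x (Suc i) \<omega>) - f xstar)
      \<le> (\<Sum>i<N. noise k i \<omega> + \<epsilon> * (G * R) + (real k - 1) * G\<^sup>2 * \<alpha> (Suc i)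
        + (F (x (i + k) \<omega>) (\<xi> (i + k) \<omega>) - F xstar (\<xi> (i + k) \<omega>)))"
    by (rule sum_mono[OF each])
  also have "\<dots> = (\<Sum>i<N. noise k i \<omega>) + real N * (\<epsilon> * (G * R)) + (real k - 1) * G\<^sup>2 * (\<Sum>i<N. \<alpha> (Suc i))
        + (\<Sum>i<N. F (x (i + k) \<omega>) (\<xi> (i + k) \<omega>) - F xstar (\<xi> (i + k) \<omega>))"
    by (simp add: sum.distrib sum_distrib_left)
  finally have early: "(\<Sum>i<N. f (x (Suc i) \<omega>) - f xstar) \<le> \<dots>" .

  have "real N * (\<epsilon> * (G * R)) \<le> real T * (\<epsilon> * (G * R))"
    using NT eps GR_nonneg by (intro mult_right_mono) auto
  moreover have "(real k - 1) * G\<^sup>2 * (\<Sum>i<N. \<alpha> (Suc i)) \<le> (real k - 1) * G\<^sup>2 * A"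
  proof (rule mult_left_mono)
    have "(\<Sum>i<N. \<alpha> (Suc i)) = (\<Sum>t=1..N. \<alpha> t)" by (simp add: sum.atLeast1_atMost_eq)
    also have "\<dots> \<le> A" by (rule A_part) (use NT in auto)
    finally show "(\<Sum>i<N. \<alpha> (Suc i)) \<le> A" .
  qed (use k in simp)
  moreover have "(\<Sum>i<N. F (x (i + k) \<omega>) (\<xi> (i + k) \<omega>) - F xstar (\<xi> (i + k) \<omega>))
      \<le> R\<^sup>2 / (2 * \<alpha> T) + G\<^sup>2 / 2 * A"
  proof -
    \<comment> \<open>With \<open>t = i + k\<close> each loss is evaluated at the iterate current
      when its sample arrives, so this is the online regret over the window from \<open>k\<close> to
      \<open>T\<close>.\<close>
    have "(\<Sum>i<N. F (x (i + k) \<omega>) (\<xi> (i + k) \<omega>) - F xstar (\<xi> (i + k) \<omega>))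
        = (\<Sum>t=k..T. F (x t \<omega>) (\<xi> t \<omega>) - F xstar (\<xi> t \<omega>))"
      using sum.shift_bounds_nat_ivl[of "\<lambda>t. F (x t \<omega>) (\<xi> t \<omega>) - F xstar (\<xi> t \<omega>)" 0 k N] NT
      by (simp add: atLeast0LessThan atLeastLessThanSuc_atLeastAtMost)
    also have "\<dots> \<le> (R\<^sup>2 / 2) / \<alpha> T + (G\<^sup>2 / 2) * (\<Sum>t=k..T. \<alpha> t)"
    proof (rule telescoping_regret[where b = "\<lambda>t. bregman \<psi> grad xstar (x t \<omega>)"])
      fix t assume "k \<le> t"
      then have t: "1 \<le> t" using k by simp
      have xt: "x t \<omega> \<in> X" by (rule x_in[OF \<omega> t])
      show "0 \<le> bregman \<psi> grad xstar (x t \<omega>)"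
        using bregman_ge[OF norm_n strong xstar_in xt] by (meson divide_nonneg_pos order_trans zero_le_power2 zero_less_numeral)
      show "bregman \<psi> grad xstar (x t \<omega>) \<le> R\<^sup>2 / 2" by (rule bregman_le[OF xstar_in xt])
      show "0 < \<alpha> t" by (rule alpha_pos[OF t])
      show "\<alpha> (Suc t) \<le> \<alpha> t" by (rule alpha_mono[OF t]) simp
      have "F (x t \<omega>) (\<xi> t \<omega>) + g (x t \<omega>) (\<xi> t \<omega>) \<bullet> (xstar - x t \<omega>) \<le> F xstar (\<xi> t \<omega>)"
        by (rule subgradient[OF xstar_in xt xi_in[OF \<omega> t]])
      then have "F (x t \<omega>) (\<xi> t \<omega>) - F xstar (\<xi> t \<omega>) \<le> g (x t \<omega>) (\<xi> t \<omega>) \<bullet> (x t \<omega> - xstar)"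
        by (simp add: inner_diff_right)
      also have "\<dots> \<le> (bregman \<psi> grad xstar (x t \<omega>) - bregman \<psi> grad xstar (x (Suc t) \<omega>)) / \<alpha> t + \<alpha> t * G\<^sup>2 / 2"
        by (rule mirror_step_regret[OF convex_X gradient alpha_pos[OF t] norm_n strong xt x_step[OF \<omega> t] g[OF t xt] xstar_in])
      finally show "F (x t \<omega>) (\<xi> t \<omega>) - F xstar (\<xi> t \<omega>)
          \<le> (bregman \<psi> grad xstar (x t \<omega>) - bregman \<psi> grad xstar (x (Suc t) \<omega>)) / \<alpha> t + \<alpha> t * (G\<^sup>2 / 2)"
        by simp
    qed (rule k(2))
    also have "\<dots> \<le> R\<^sup>2 / (2 * \<alpha> T) + G\<^sup>2 / 2 * A"
      using A_part[of "{k..T}"] k by (intro add_mono mult_left_mono) auto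
    finally show ?thesis .
  qed
  ultimately show ?case using split late early
    unfolding A_def[symmetric] N_def[symmetric] by (simp add: algebra_simps)
qed

section \<open>Measurability of the optimality gap\<close>

lemma f_continuous: "continuous_on X f"
proof -
  have "(f \<longlongrightarrow> f z) (at z within X)" if z: "z \<in> X" for z
  proof -
    have "((\<lambda>y. n (y - z)) \<longlongrightarrow> n (z - z)) (at z within X)"
      by (intro continuous_on_tendsto_compose[OF is_norm_continuous[OF norm_n]] tendsto_intros) auto
    then have lim: "((\<lambda>y. G * n (y - z)) \<longlongrightarrow> 0) (at z within X)"
      using is_norm_zero[OF norm_n] by (intro tendsto_mult_right_zero) simp
    have "((\<lambda>y. f y - f z) \<longlongrightarrow> 0) (at z within X)"
      by (rule Lim_null_comparison[OF _ lim])
        (use f_lipschitz z in \<open>auto simp: eventually_at_filter\<close>)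
    then show ?thesis by (simp add: LIM_zero_iff)
  qed
  then show ?thesis by (simp add: continuous_on_def)
qed

lemma average_measurable:
  assumes T: "1 \<le> T"
  shows "(\<lambda>\<omega>. f ((1 / real T) *\<^sub>R (\<Sum>t=1..T. x t \<omega>))) \<in> borel_measurable M"
proof -
  have "x t \<in> borel_measurable M" if "t \<in> {1..T}" for t
    using measurable_from_subalg[OF subalgebra_past x_measurable, of "t - 1"] that by simp
  then have "(\<lambda>\<omega>. (1 / real T) *\<^sub>R (\<Sum>t=1..T. x t \<omega>)) \<in> borel_measurable M"
    by (intro borel_measurable_scaleR borel_measurable_sum) auto
  then have m: "(\<lambda>\<omega>. (1 / real T) *\<^sub>R (\<Sum>t=1..T. x t \<omega>)) \<in> M \<rightarrow>\<^sub>M restrict_space borel X"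
    using f_average(1)[OF T] x_in by (intro measurable_restrict_space2) (auto simp del: One_nat_def)
  show ?thesis
    by (rule measurable_compose[OF m borel_measurable_continuous_on_restrict[OF f_continuous]])
qed

end

section \<open>The rate for one accuracy\<close>

context ergodic_mirror_descent
begin

definition rate :: "nat \<Rightarrow> real \<Rightarrow> real \<Rightarrow> nat \<Rightarrow> real" where
  "rate T \<delta> \<epsilon> k = R\<^sup>2 / (2 * real T * \<alpha> T) + G\<^sup>2 / (2 * real T) * (\<Sum>t=1..T. \<alpha> t)
     + (real k - 1) / real T * (G\<^sup>2 * (\<Sum>t=1..T. \<alpha> t) + G * R) + \<epsilon> * G * R
     + 4 * G * R * sqrt (real k * ln (real k / \<delta>) / real T)"

context
  fixes T k :: nat and \<delta> \<epsilon> :: real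
  assumes k: "1 \<le> k" "k \<le> T" and \<delta>: "0 < \<delta>" "\<delta> < 1" and \<epsilon>: "0 < \<epsilon>"
begin

lemma rate_nonneg: "0 \<le> rate T \<delta> \<epsilon> k"
proof -
  have "0 \<le> (\<Sum>t=1..T. \<alpha> t)" using alpha_pos by (intro sum_nonneg) (auto intro: less_imp_le)
  moreover have "0 \<le> ln (real k / \<delta>)" using k \<delta> by (intro ln_ge_zero) (simp add: field_simps)
  ultimately show ?thesis
    unfolding rate_def using k \<epsilon> G_nonneg R_nonneg alpha_pos[of T]
    by (intro add_nonneg_nonneg mult_nonneg_nonneg divide_nonneg_nonneg) (auto intro: less_imp_le)
qed

lemma rate_scaled:
  "real T * rate T \<delta> \<epsilon> k = 4 * (G * R) * sqrt (real k * real T * ln (real k / \<delta>))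
     + real T * (\<epsilon> * (G * R)) + R\<^sup>2 / (2 * \<alpha> T) + G\<^sup>2 / 2 * (\<Sum>t=1..T. \<alpha> t)
     + (real k - 1) * (G\<^sup>2 * (\<Sum>t=1..T. \<alpha> t) + G * R)"
proof -
  have T: "0 < real T" using k by simp
  have "real k * real T * ln (real k / \<delta>) = (real T)\<^sup>2 * (real k * ln (real k / \<delta>) / real T)"
    using T by (simp add: power2_eq_square)
  then have "sqrt (real k * real T * ln (real k / \<delta>)) = sqrt ((real T)\<^sup>2 * (real k * ln (real k / \<delta>) / real T))"
    by (rule arg_cong)
  also have "\<dots> = real T * sqrt (real k * ln (real k / \<delta>) / real T)"
    by (simp only: real_sqrt_mult real_sqrt_abs abs_of_nat)
  finally have "sqrt (real k * real T * ln (real k / \<delta>)) = real T * sqrt (real k * ln (real k / \<delta>) / real T)" .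
  moreover have "real T * (R\<^sup>2 / (2 * real T * \<alpha> T)) = R\<^sup>2 / (2 * \<alpha> T)" using T by simp
  moreover have "real T * (G\<^sup>2 / (2 * real T) * S) = G\<^sup>2 / 2 * S" for S using T by simp
  moreover have "real T * ((real k - 1) / real T * S) = (real k - 1) * S" for S using T by simp
  ultimately show ?thesis unfolding rate_def by (simp only: distrib_left) (simp add: mult_ac)
qed

lemma rate_exceeded:
  assumes mixed: "AE \<omega> in M. \<forall>s. d_TV (K s (s + k) \<omega>) \<pi> \<le> \<epsilon>"
  shows "P.prob {\<omega> \<in> space M. rate T \<delta> \<epsilon> k < f ((1 / real T) *\<^sub>R (\<Sum>t=1..T. x t \<omega>)) - f xstar} \<le> \<delta>"
proof (cases "G * R = 0")
  \<comment> \<open>\<open>azuma\<close> needs a positive bound on the increments. If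
    \<open>G * R\<close> vanishes, the gap is at most \<open>G * R = 0\<close> on every path, and
    the rate is nonnegative.\<close>
  case True
  have "f ((1 / real T) *\<^sub>R (\<Sum>t=1..T. x t \<omega>)) - f xstar \<le> rate T \<delta> \<epsilon> k" if "\<omega> \<in> space M" for \<omega>
    using f_diff_le[OF f_average(1) xstar_in, of T "\<lambda>t. x t \<omega>"] x_in[OF that] k True rate_nonneg
    by (simp del: One_nat_def)
  then have empty: "{\<omega> \<in> space M. rate T \<delta> \<epsilon> k < f ((1 / real T) *\<^sub>R (\<Sum>t=1..T. x t \<omega>)) - f xstar} = {}"
    by (auto simp: not_less simp del: One_nat_def)
  show ?thesis unfolding empty using \<delta> by simp
next
  case False
  then have GR: "0 < G * R" using GR_nonneg by linarith
  have T: "0 < real T" using k by simp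
  have [measurable]: "noise k i \<in> borel_measurable M" for i
    by (rule measurable_from_subalg[OF subalgebra_past noise_measurable[OF k(1)]])
  have "P.prob {\<omega> \<in> space M. rate T \<delta> \<epsilon> k < f ((1 / real T) *\<^sub>R (\<Sum>t=1..T. x t \<omega>)) - f xstar}
      \<le> P.prob {\<omega> \<in> space M. 4 * (G * R) * sqrt (real k * real T * ln (real k / \<delta>)) \<le> (\<Sum>i<Suc T - k. noise k i \<omega>)}"
  proof (rule P.finite_measure_mono_AE)
    show "AE \<omega> in M. \<omega> \<in> {\<omega> \<in> space M. rate T \<delta> \<epsilon> k < f ((1 / real T) *\<^sub>R (\<Sum>t=1..T. x t \<omega>)) - f xstar}
        \<longrightarrow> \<omega> \<in> {\<omega> \<in> space M. 4 * (G * R) * sqrt (real k * real T * ln (real k / \<delta>)) \<le> (\<Sum>i<Suc T - k. noise k i \<omega>)}"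
      using regret_decomposition[OF k mixed]
    proof eventually_elim
      case (elim \<omega>)
      let ?W = "f ((1 / real T) *\<^sub>R (\<Sum>t=1..T. x t \<omega>)) - f xstar"
      have "real T * rate T \<delta> \<epsilon> k < real T * ?W" if "rate T \<delta> \<epsilon> k < ?W"
        using that T by (rule mult_strict_left_mono)
      then show ?case using elim unfolding rate_scaled by (auto simp del: One_nat_def)
    qed
  qed measurable
  also have "\<dots> \<le> \<delta>" by (rule noise_tail[OF k GR \<delta>])
  finally show ?thesis .
qed

end

end

section \<open>The convergence rate\<close>

text \<open>The infimum in \<open>mixing_time\<close> ranges over lags of at least 1 and is infinite
  when there are none, and an almost sure event of a probability space contains a point. A lag of at
  least 1 keeps the delayed sample strictly after the time of conditioning.\<close>

lemma uniform_mixing_ge_1: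
  assumes M: "prob_space M" and mix: "uniform_mixing M \<pi> K \<tau>TV \<tau>hel" and \<epsilon>: "0 < \<epsilon>"
  shows "1 \<le> \<tau>TV \<epsilon>"
proof -
  have "AE \<omega> in M. mixing_time d_TV \<pi> K 0 \<epsilon> \<omega> \<le> enat (\<tau>TV \<epsilon>)"
    using mix unfolding uniform_mixing_def by eventually_elim (use \<epsilon> in blast)
  then obtain \<omega> where "mixing_time d_TV \<pi> K 0 \<epsilon> \<omega> \<le> enat (\<tau>TV \<epsilon>)"
    using eventually_happens prob_space.ae_filter_bot[OF M] by blast
  moreover have "enat 1 \<le> mixing_time d_TV \<pi> K 0 \<epsilon> \<omega>"
    unfolding mixing_time_def by (rule INF_greatest) auto
  ultimately show ?thesis using enat_ord_simps(1) order_trans by blast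
qed

theorem theorem2:
  fixes \<pi> :: "'x measure"
    and M :: "'w measure"
    and X :: "(real ^ 'd) set"
    and nrm :: "real ^ 'd \<Rightarrow> real"
    and F :: "real ^ 'd \<Rightarrow> 'x \<Rightarrow> ereal"
    and g :: "real ^ 'd \<Rightarrow> 'x \<Rightarrow> real ^ 'd"
    and \<psi> :: "real ^ 'd \<Rightarrow> real"
    and grad :: "real ^ 'd \<Rightarrow> real ^ 'd"
    and R G \<delta> :: real
    and \<xi> :: "nat \<Rightarrow> 'w \<Rightarrow> 'x"
    and K :: "nat \<Rightarrow> nat \<Rightarrow> 'w \<Rightarrow> 'x measure"
    and \<tau>TV \<tau>hel :: "real \<Rightarrow> nat"
    and \<alpha> :: "nat \<Rightarrow> real"
    and x :: "nat \<Rightarrow> 'w \<Rightarrow> real ^ 'd"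
    and x1 xstar :: "real ^ 'd"
    and T :: nat
  assumes "prob_space \<pi>" and "prob_space M"
    and "compact X" and "convex X"
    and "is_norm nrm"
    and F_convex: "\<And>s. s \<in> space \<pi> \<Longrightarrow> closed_convex_fun (\<lambda>z. F z s)"
    and F_domain: "\<And>s. s \<in> space \<pi> \<Longrightarrow> X \<subseteq> effective_domain (\<lambda>z. F z s)"
    and F_integrable: "\<And>z. z \<in> X \<Longrightarrow> integrable \<pi> (\<lambda>s. real_of_ereal (F z s))"
    and g_subgradient: "\<And>z s. z \<in> X \<Longrightarrow> s \<in> space \<pi> \<Longrightarrow> g z s \<in> subdifferential (\<lambda>y. F y s) z"
    and g_measurable: "(\<lambda>(z, s). g z s) \<in> restrict_space borel X \<Otimes>\<^sub>M \<pi> \<rightarrow>\<^sub>M borel"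
    and \<psi>_convex: "convex_on X \<psi>"
    and \<psi>_gradient: "gradient_on X \<psi> grad"
    and \<psi>_strong: "strongly_convex_1 nrm X \<psi> grad"
    and R: "0 \<le> R" "\<And>y z. y \<in> X \<Longrightarrow> z \<in> X \<Longrightarrow> bregman \<psi> grad y z \<le> R\<^sup>2 / 2"
    and \<xi>_measurable: "\<And>t. 1 \<le> t \<Longrightarrow> \<xi> t \<in> M \<rightarrow>\<^sub>M \<pi>"
    and K: "\<And>s t. s < t \<Longrightarrow> cond_distribution M (past M \<pi> \<xi> s) \<pi> (\<xi> t) (K s t)"
    and mixing: "uniform_mixing M \<pi> K \<tau>TV \<tau>hel" "mixed_at_lag M \<pi> K \<tau>TV"
    and lipschitz: "AE s in \<pi>. lipschitz_over nrm G X (\<lambda>z. F z s)"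
      "subgradients_bounded M \<xi> nrm G X g"
    and \<alpha>: "\<And>t. 1 \<le> t \<Longrightarrow> 0 < \<alpha> t" "\<And>s t. 1 \<le> s \<Longrightarrow> s \<le> t \<Longrightarrow> \<alpha> t \<le> \<alpha> s"
    and x_init: "x1 \<in> X" "\<And>\<omega>. \<omega> \<in> space M \<Longrightarrow> x 1 \<omega> = x1"
    and x_emd: "\<And>\<omega>. \<omega> \<in> space M \<Longrightarrow> emd_path X \<psi> grad \<alpha> g (\<lambda>t. \<xi> t \<omega>) (\<lambda>t. x t \<omega>)"
    and "xstar \<in> X"
    and "0 < \<delta>" "\<delta> < 1"
    and "1 \<le> T"
  shows "measure M {\<omega> \<in> space M. \<forall>\<epsilon>>0. real (\<tau>TV \<epsilon>) \<le> real T / 2 \<longrightarrow>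
      expected_fun \<pi> F ((1 / real T) *\<^sub>R (\<Sum>t=1..T. x t \<omega>)) - expected_fun \<pi> F xstar
        \<le> R\<^sup>2 / (2 * real T * \<alpha> T)
          + G\<^sup>2 / (2 * real T) * (\<Sum>t=1..T. \<alpha> t)
          + (real (\<tau>TV \<epsilon>) - 1) / real T * (G\<^sup>2 * (\<Sum>t=1..T. \<alpha> t) + G * R)
          + \<epsilon> * G * R
          + 4 * G * R * sqrt (real (\<tau>TV \<epsilon>) * ln (real (\<tau>TV \<epsilon>) / \<delta>) / real T)} \<ge> 1 - \<delta>"
proof -
  let ?F = "\<lambda>z s. real_of_ereal (F z s)"
  interpret \<pi>: prob_space \<pi> by fact
  have finite: "\<bar>F z s\<bar> \<noteq> \<infinity>" if "z \<in> X" "s \<in> space \<pi>" for z s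
    using F_domain[OF that(2)] that(1) F_convex[OF that(2)]
    by (auto simp: effective_domain_def closed_convex_fun_def)
  have G: "0 \<le> G"
  proof -
    have "AE s in \<pi>. 0 \<le> G" using lipschitz(1) by eventually_elim (simp add: lipschitz_over_def)
    then show ?thesis by simp
  qed
  interpret ergodic_mirror_descent \<pi> M X nrm ?F g \<psi> grad R G \<xi> K \<alpha> x x1 xstar
  proof (rule ergodic_mirror_descent.intro)
    show "?F z s + g z s \<bullet> (y - z) \<le> ?F y s" if "y \<in> X" "z \<in> X" "s \<in> space \<pi>" for y z s
    proof -
      have "F z s + ereal (g z s \<bullet> (y - z)) \<le> F y s"
        using g_subgradient[OF that(2,3)] by (simp add: subdifferential_def)
      then show ?thesis
        using finite[OF that(1,3)] finite[OF that(2,3)] by (cases "F z s"; cases "F y s") auto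
    qed
    show "AE s in \<pi>. \<forall>y\<in>X. \<forall>z\<in>X. \<bar>?F y s - ?F z s\<bar> \<le> G * nrm (y - z)"
      using lipschitz(1) by eventually_elim (auto simp: lipschitz_over_def)
  qed (fact assms G)+
  have f: "expected_fun \<pi> F z = f z" for z by (simp add: expected_fun_def f_def)
  let ?W = "\<lambda>\<omega>. f ((1 / real T) *\<^sub>R (\<Sum>t=1..T. x t \<omega>)) - f xstar"
  have mixed: "AE \<omega> in M. \<forall>s. d_TV (K s (s + \<tau>TV \<epsilon>) \<omega>) \<pi> \<le> \<epsilon>" if "0 < \<epsilon>" for \<epsilon>
    using mixing(2) unfolding mixed_at_lag_def by eventually_elim (use that in blast)
  have "1 - \<delta> \<le> P.prob {\<omega> \<in> space M. \<forall>\<epsilon>\<in>{\<epsilon>. 0 < \<epsilon> \<and> real (\<tau>TV \<epsilon>) \<le> real T / 2}. ?W \<omega> \<le> rate T \<delta> \<epsilon> (\<tau>TV \<epsilon>)}"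
  proof (rule P.prob_all_le)
    show "?W \<in> borel_measurable M"
      using average_measurable[OF \<open>1 \<le> T\<close>] by (intro borel_measurable_diff) auto
    fix \<epsilon> assume "\<epsilon> \<in> {\<epsilon>. 0 < \<epsilon> \<and> real (\<tau>TV \<epsilon>) \<le> real T / 2}"
    then have \<epsilon>: "0 < \<epsilon>" and "real (\<tau>TV \<epsilon>) \<le> real T" by auto
    then have k: "1 \<le> \<tau>TV \<epsilon>" "\<tau>TV \<epsilon> \<le> T"
      using uniform_mixing_ge_1[OF \<open>prob_space M\<close> mixing(1)] by auto
    show "0 \<le> rate T \<delta> \<epsilon> (\<tau>TV \<epsilon>)" by (rule rate_nonneg[OF k \<open>0 < \<delta>\<close> \<open>\<delta> < 1\<close> \<epsilon>])
    show "P.prob {\<omega> \<in> space M. rate T \<delta> \<epsilon> (\<tau>TV \<epsilon>) < ?W \<omega>} \<le> \<delta>"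
      by (rule rate_exceeded[OF k \<open>0 < \<delta>\<close> \<open>\<delta> < 1\<close> \<epsilon> mixed[OF \<epsilon>]])
  qed (use \<open>0 < \<delta>\<close> in simp)
  also have "{\<omega> \<in> space M. \<forall>\<epsilon>\<in>{\<epsilon>. 0 < \<epsilon> \<and> real (\<tau>TV \<epsilon>) \<le> real T / 2}. ?W \<omega> \<le> rate T \<delta> \<epsilon> (\<tau>TV \<epsilon>)}
      = {\<omega> \<in> space M. \<forall>\<epsilon>>0. real (\<tau>TV \<epsilon>) \<le> real T / 2 \<longrightarrow> ?W \<omega> \<le> rate T \<delta> \<epsilon> (\<tau>TV \<epsilon>)}"
    by auto
  finally show ?thesis unfolding f rate_def .
qed

end
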